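(* There exists a deterministic, fully coherent, ancilla-free algorithm $\mathcal A$ that solves the single-qubit Gross--Pitaevskii simulation problem (defined in the context) for all $g>0$, $T>0$, $0<\xi<1$ and $0<\epsilon<1$, using calls to the initial state preparation oracle $U_0$ (any unitary satisfying $U_0|0\rangle=|\psi_+(0)\rangle$ or $U_0|0\rangle=|\psi_-(0)\rangle$) and its inverse $U_0^\dagger$. It prepares $\rho_\pm(T)$ exactly, and its worst-case query count satisfies $$Q_{\mathcal A}^{\rm wc}(g,T,\epsilon)\le\frac{3\pi}{2\sqrt2}\,e^{gT/2}\le\frac{3\pi}{\sqrt2}\cosh\frac{gT}{2}.$$ Moreover, the optimal worst-case query complexity $Q_{\rm opt}^{\rm wc}(g,T,\epsilon)$ satisfies $$Q_{\rm opt}^{\rm wc}(g,T,\epsilon)=\Theta\left(\cosh\frac{gT}{2}\right)=\Theta\left(e^{gT/2}\right)$$ for every fixed $0<\epsilon<1$ and sufficiently large $gT$; that is, for every $0<\epsilon<1$ there are constants $c_1,c_2,\kappa>0$ such that $c_1e^{gT/2}\le Q_{\rm opt}^{\rm wc}(g,T,\epsilon)\le c_2e^{gT/2}$ for all $g,T>0$ with $gT\ge\kappa$.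
   Context: $X,Y,Z$ are the Pauli matrices, $\|A\|_1=\operatorname{Tr}\sqrt{A^\dagger A}$. The single-qubit discrete Gross--Pitaevskii equation with nonlinearity strength $g>0$ is $$i\frac{d}{dt}|\psi(t)\rangle=\left[\frac g4X+\frac g2\left(\rho(t)+Z\rho(t)Z\right)\right]|\psi(t)\rangle,\qquad \rho(t)=|\psi(t)\rangle\langle\psi(t)|.$$ For $0<\xi<1$, the two candidate initial states are the pure states $\rho_\pm(0)=|\psi_\pm(0)\rangle\langle\psi_\pm(0)|$ with Bloch vectors (for $\rho=\frac12(\mathbb I+xX+yY+zZ)$, the Bloch vector is $(x,y,z)$) $$r_\pm(0)=\left(1-\xi,\ \pm\sqrt{\xi(1-\xi)},\ \pm\sqrt\xi\right)$$ (same sign in the last two components; the global phases of $|\psi_\pm(0)\rangle$ are fixed arbitrarily). $\rho_\pm(t)$ denotes the corresponding exact solution; its Bloch vector is $r_\pm(t)=\left(\tanh^2a(t),\ \pm\frac{\tanh a(t)}{\cosh a(t)},\ \pm\frac1{\cosh a(t)}\right)$ with $a(t)=\operatorname{artanh}\sqrt{1-\xi}-gt/2$. Simulation problem: the parameters $g>0$, $0<\xi<1$, $T>0$ and accuracy $0<\epsilon<1$ are known when the circuit is designed ($\xi$ and $T$ are specified independently). A unitary oracle $U_0$ on one qubit is given with $U_0|0\rangle=|\psi_+(0)\rangle$ or $U_0|0\rangle=|\psi_-(0)\rangle$; which of the two holds, and the action of $U_0$ on $|1\rangle$, are not known. The algorithm must output, for every such $U_0$, a state $\widetilde\rho$ with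 $\|\widetilde\rho-\rho_\pm(T)\|_1\le\epsilon$ for the sign matching $U_0$. For fixed $(g,\xi,T,\epsilon)$ the non-query gates and their parameters, the number and placement of oracle queries, and whether each query is $U_0$ or $U_0^\dagger$, are the same for both candidates and for all allowed oracles; they may depend on $(g,\xi,T,\epsilon)$. A (deterministic, coherent) algorithm is thus, for each $(g,\xi,T,\epsilon)$, a circuit of fixed non-query unitary gates interleaved with applications of $U_0$ or $U_0^\dagger$ to a qubit, starting from a fixed state (with the system qubit in $|0\rangle$), possibly with ancilla qubits, whose output is the state of the system qubit. It is ancilla-free if the circuit acts on the single system qubit only, i.e. it is a product $W_qO_qW_{q-1}\cdots O_1W_0$ applied to $|0\rangle$ with $O_j\in\{U_0,U_0^\dagger\}$ and $W_j$ fixed single-qubit unitaries. For an algorithm $\mathcal A$ solving this problem, $Q_{\mathcal A}(g,T,\xi,\epsilon)$ is the number of queries to $U_0$ and $U_0^\dagger$ (maximized over all allowed oracles), and $Q^{\rm wc}_{\mathcal A}(g,T,\epsilon)=\sup_{0<\xi<1}Q_{\mathcal A}(g,T,\xi,\epsilon)$. $Q^{\rm wc}_{\rm opt}(g,T,\epsilon)$ is the minimum of $Q^{\rm wc}_{\mathcal A}(g,T,\epsilon)$ over all deterministic algorithms $\mathcal A$ solving the problem. *)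

theory Defs
  imports Complex_Main "HOL-Library.Extended_Real" "Jordan_Normal_Form.Schur_Decomposition"
begin

definition unitary_mat :: "nat \<Rightarrow> complex mat \<Rightarrow> bool" where
  "unitary_mat d U \<longleftrightarrow> U \<in> carrier_mat d d
     \<and> mat_adjoint U * U = 1\<^sub>m d \<and> U * mat_adjoint U = 1\<^sub>m d"

definition psd_mat :: "complex mat \<Rightarrow> bool" where
  "psd_mat A \<longleftrightarrow> square_mat A \<and> mat_adjoint A = A
     \<and> (\<forall>v \<in> carrier_vec (dim_row A). 0 \<le> Re ((A *\<^sub>v v) \<bullet>c v))"

definition mat_sqrt :: "complex mat \<Rightarrow> complex mat" where
  "mat_sqrt A = (THE B. B \<in> carrier_mat (dim_row A) (dim_row A) \<and> psd_mat B \<and> B * B = A)"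

definition mat_trace :: "complex mat \<Rightarrow> complex" where
  "mat_trace A = (\<Sum>i<dim_row A. A $$ (i, i))"

definition trace_norm :: "complex mat \<Rightarrow> real" where
  "trace_norm A = Re (mat_trace (mat_sqrt (mat_adjoint A * A)))"

definition ketbra :: "complex vec \<Rightarrow> complex mat" where
  "ketbra v = mat (dim_vec v) (dim_vec v) (\<lambda>(i, j). v $ i * cnj (v $ j))"

definition pauli_X :: "complex mat" where
  "pauli_X = mat_of_rows_list 2 [[0, 1], [1, 0]]"

definition pauli_Y :: "complex mat" where
  "pauli_Y = mat_of_rows_list 2 [[0, - \<i>], [\<i>, 0]]"

definition pauli_Z :: "complex mat" where
  "pauli_Z = mat_of_rows_list 2 [[1, 0], [0, - 1]]"

definition bloch_state :: "real \<times> real \<times> real \<Rightarrow> complex mat" where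
  "bloch_state = (\<lambda>(x, y, z). (1 / 2) \<cdot>\<^sub>m
     (1\<^sub>m 2 + of_real x \<cdot>\<^sub>m pauli_X + of_real y \<cdot>\<^sub>m pauli_Y + of_real z \<cdot>\<^sub>m pauli_Z))"

definition gp_hamiltonian :: "real \<Rightarrow> complex mat \<Rightarrow> complex mat" where
  "gp_hamiltonian g \<rho> = of_real (g / 4) \<cdot>\<^sub>m pauli_X
     + of_real (g / 2) \<cdot>\<^sub>m (\<rho> + pauli_Z * \<rho> * pauli_Z)"

definition gp_solution :: "real \<Rightarrow> (real \<Rightarrow> complex vec) \<Rightarrow> bool" where
  "gp_solution g \<psi> \<longleftrightarrow> (\<forall>t\<ge>0. \<psi> t \<in> carrier_vec 2 \<and>
     (\<forall>i<2. ((\<lambda>s. \<psi> s $ i) has_vector_derivative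
        - \<i> * (gp_hamiltonian g (ketbra (\<psi> t)) *\<^sub>v \<psi> t) $ i) (at t within {0..})))"

text \<open>\<open>gp_state g \<phi> t\<close> is the density operator at time \<open>t \<ge> 0\<close> of the solution started in \<open>\<phi>\<close>.
  The initial value problem has exactly one solution on \<open>[0, \<infinity>)\<close>: the right-hand side is
  locally Lipschitz and the norm is conserved.\<close>

definition gp_state :: "real \<Rightarrow> complex vec \<Rightarrow> real \<Rightarrow> complex mat" where
  "gp_state g \<phi> t = (THE \<rho>. \<exists>\<psi>. gp_solution g \<psi> \<and> \<psi> 0 = \<phi> \<and> \<rho> = ketbra (\<psi> t))"

text \<open>The sign \<open>\<plusminus>\<close> is represented by a real \<open>\<sigma> \<in> {1, -1}\<close>.\<close>

definition initial_bloch :: "real \<Rightarrow> real \<Rightarrow> real \<times> real \<times> real" where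
  "initial_bloch \<sigma> \<xi> = (1 - \<xi>, \<sigma> * sqrt (\<xi> * (1 - \<xi>)), \<sigma> * sqrt \<xi>)"

text \<open>\<open>\<psi>0 \<sigma> \<xi>\<close> is a state vector with the prescribed Bloch vector; the global phases are
  arbitrary, so every family \<open>\<psi>0\<close> satisfying the following predicate is admitted.\<close>

definition initial_states :: "(real \<Rightarrow> real \<Rightarrow> complex vec) \<Rightarrow> bool" where
  "initial_states \<psi>0 \<longleftrightarrow> (\<forall>\<sigma> \<in> {1, -1}. \<forall>\<xi> \<in> {0<..<1}.
     \<psi>0 \<sigma> \<xi> \<in> carrier_vec 2 \<and> ketbra (\<psi>0 \<sigma> \<xi>) = bloch_state (initial_bloch \<sigma> \<xi>))"

definition oracle_for :: "complex vec \<Rightarrow> complex mat \<Rightarrow> bool" where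
  "oracle_for \<phi> U \<longleftrightarrow> unitary_mat 2 U \<and> U *\<^sub>v unit_vec 2 0 = \<phi>"

text \<open>States of \<open>n\<close> qubits are vectors of dimension \<open>2 ^ n\<close>; the basis index \<open>i\<close> encodes in its
  binary digit \<open>k\<close> the value of qubit \<open>k\<close>. Qubit \<open>0\<close> is the system qubit, the others are ancillas.
  In \<open>on_qubit\<close>, equality after clearing digit \<open>k\<close> says that all other qubits agree.\<close>

definition on_qubit :: "nat \<Rightarrow> nat \<Rightarrow> complex mat \<Rightarrow> complex mat" where
  "on_qubit n k U = mat (2 ^ n) (2 ^ n) (\<lambda>(i, j).
     if unset_bit k i = unset_bit k j
     then U $$ (of_bool (bit i k), of_bool (bit j k)) else 0)"

text \<open>A step \<open>(inverse, k, W)\<close> queries the oracle (its inverse if \<open>inverse\<close> holds) on qubit \<open>k\<close>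
  and then applies the fixed gate \<open>W\<close> to the whole register.\<close>

record query_circuit =
  n_qubits :: nat
  init_state :: "complex vec"
  first_gate :: "complex mat"
  query_steps :: "(bool \<times> nat \<times> complex mat) list"

definition wf_circuit :: "query_circuit \<Rightarrow> bool" where
  "wf_circuit C \<longleftrightarrow> n_qubits C \<ge> 1
     \<and> init_state C \<in> carrier_vec (2 ^ n_qubits C)
     \<and> init_state C \<bullet>c init_state C = 1
     \<and> (\<forall>i < 2 ^ n_qubits C. bit i 0 \<longrightarrow> init_state C $ i = 0)
     \<and> unitary_mat (2 ^ n_qubits C) (first_gate C)
     \<and> (\<forall>(inverse, k, W) \<in> set (query_steps C).
          k < n_qubits C \<and> unitary_mat (2 ^ n_qubits C) W)"

definition ancilla_free :: "query_circuit \<Rightarrow> bool" where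
  "ancilla_free C \<longleftrightarrow> n_qubits C = 1 \<and> init_state C = unit_vec 2 0"

definition run_step ::
    "nat \<Rightarrow> complex mat \<Rightarrow> bool \<times> nat \<times> complex mat \<Rightarrow> complex vec \<Rightarrow> complex vec" where
  "run_step n U = (\<lambda>(inverse, k, W) v.
     W *\<^sub>v (on_qubit n k (if inverse then mat_adjoint U else U) *\<^sub>v v))"

definition final_state :: "query_circuit \<Rightarrow> complex mat \<Rightarrow> complex vec" where
  "final_state C U =
     fold (run_step (n_qubits C) U) (query_steps C) (first_gate C *\<^sub>v init_state C)"

text \<open>Partial trace of \<open>|v><v|\<close> over all qubits but the system qubit.\<close>

definition system_state :: "nat \<Rightarrow> complex vec \<Rightarrow> complex mat" where
  "system_state n v = mat 2 2 (\<lambda>(a, b).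
     \<Sum>k < 2 ^ (n - 1). v $ (2 * k + a) * cnj (v $ (2 * k + b)))"

definition circuit_output :: "query_circuit \<Rightarrow> complex mat \<Rightarrow> complex mat" where
  "circuit_output C U = system_state (n_qubits C) (final_state C U)"

text \<open>The circuit, and hence this number, does not depend on the oracle.\<close>

definition num_queries :: "query_circuit \<Rightarrow> nat" where
  "num_queries C = length (query_steps C)"

text \<open>An algorithm assigns a circuit to the parameters \<open>g\<close>, \<open>T\<close>, \<open>\<xi>\<close>, \<open>\<epsilon>\<close>, in this order.\<close>

type_synonym algorithm = "real \<Rightarrow> real \<Rightarrow> real \<Rightarrow> real \<Rightarrow> query_circuit"

definition solves :: "(real \<Rightarrow> real \<Rightarrow> complex vec) \<Rightarrow> algorithm \<Rightarrow> bool" where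
  "solves \<psi>0 A \<longleftrightarrow> (\<forall>g>0. \<forall>T>0. \<forall>\<xi> \<in> {0<..<1}. \<forall>\<epsilon> \<in> {0<..<1}.
     wf_circuit (A g T \<xi> \<epsilon>) \<and>
     (\<forall>\<sigma> \<in> {1, -1}. \<forall>U. oracle_for (\<psi>0 \<sigma> \<xi>) U \<longrightarrow>
        trace_norm (circuit_output (A g T \<xi> \<epsilon>) U - gp_state g (\<psi>0 \<sigma> \<xi>) T) \<le> \<epsilon>))"

definition prepares_exactly :: "(real \<Rightarrow> real \<Rightarrow> complex vec) \<Rightarrow> algorithm \<Rightarrow> bool" where
  "prepares_exactly \<psi>0 A \<longleftrightarrow> (\<forall>g>0. \<forall>T>0. \<forall>\<xi> \<in> {0<..<1}. \<forall>\<epsilon> \<in> {0<..<1}.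
     \<forall>\<sigma> \<in> {1, -1}. \<forall>U. oracle_for (\<psi>0 \<sigma> \<xi>) U \<longrightarrow>
        circuit_output (A g T \<xi> \<epsilon>) U = gp_state g (\<psi>0 \<sigma> \<xi>) T)"

definition Q_wc :: "algorithm \<Rightarrow> real \<Rightarrow> real \<Rightarrow> real \<Rightarrow> enat" where
  "Q_wc A g T \<epsilon> = (SUP \<xi> \<in> {0<..<1}. enat (num_queries (A g T \<xi> \<epsilon>)))"

text \<open>As \<open>enat\<close> is well-ordered, the infimum is a minimum as soon as some algorithm solves the problem.\<close>

definition Q_opt :: "(real \<Rightarrow> real \<Rightarrow> complex vec) \<Rightarrow> real \<Rightarrow> real \<Rightarrow> real \<Rightarrow> enat" where
  "Q_opt \<psi>0 g T \<epsilon> = (INF A \<in> {A. solves \<psi>0 A}. Q_wc A g T \<epsilon>)"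

end

theory Submission
  imports Defs "HOL-Analysis.L2_Norm" "HOL-Analysis.Convex"
begin

text \<open>
  The solution is explicit: in the \<open>X\<close> eigenbasis its amplitudes are
  \<open>(1 + \<i> tanh a) / sqrt 2\<close> and \<open>\<sigma> / (sqrt 2 cosh a)\<close> with \<open>a = a0 - g t / 2\<close>, up to a global phase.
  So the sign \<open>\<sigma>\<close> is carried by the sign of the \<open>X = -1\<close> amplitude, of modulus \<open>sin \<theta>\<close> initially and
  \<open>sin \<Theta>\<close> at time \<open>T\<close>, and evolving the state means changing the angle \<open>\<theta>\<close> into \<open>\<Theta>\<close>.

  Upper bound: \<open>U P U\<^sup>\<dagger>\<close> with a phase gate \<open>P\<close> on \<open>|0>\<close> is a rotation about the unknown state
  that does not depend on \<open>U |1>\<close>; alternating it with rotations about the \<open>X\<close> axis is amplitude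
  amplification, which takes \<open>\<theta>\<close> to \<open>(2 m + 1) \<theta>\<close>. Adjusting the two phases of the last block gives
  \<open>\<Theta>\<close> exactly. As \<open>\<Theta> \<le> \<pi> / (2 sqrt 2) sin \<Theta>\<close> and \<open>sin \<Theta> / sin \<theta> \<le> exp (g T / 2)\<close>, this takes at most
  \<open>3 \<pi> / (2 sqrt 2) exp (g T / 2)\<close> queries.

  Lower bound: for \<open>\<xi> = 1 / cosh\<^sup>2 (g T / 2)\<close> the two states at time \<open>T\<close> are orthogonal, whereas there
  are oracles for the initial states which, up to a phase, differ by \<open>sqrt (2 \<xi>)\<close> in operator norm.
  A hybrid argument shows that \<open>q\<close> queries separate the final states by at most \<open>q sqrt (2 \<xi>)\<close>.
\<close>

section \<open>Two-dimensional linear algebra\<close>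

text \<open>\<open>v2\<close> and \<open>m2\<close> serve as normal forms: once vectors and matrices
  are written this way, the simplifier reduces identities between them to scalar identities between
  entries.\<close>

definition v2 :: "complex \<Rightarrow> complex \<Rightarrow> complex vec" where
  "v2 a b = vec 2 (\<lambda>i. if i = 0 then a else b)"

definition m2 :: "complex \<Rightarrow> complex \<Rightarrow> complex \<Rightarrow> complex \<Rightarrow> complex mat" where
  "m2 a b c d = mat 2 2 (\<lambda>(i, j). if i = 0 then if j = 0 then a else b else if j = 0 then c else d)"

lemma less_two_iff: "i < 2 \<longleftrightarrow> i = 0 \<or> i = (1::nat)"
  by auto

lemma sum_lessThan_two: "(\<Sum>i<2::nat. f i) = f 0 + (f 1 :: 'a :: comm_monoid_add)"
  by (simp add: numeral_2_eq_2)

lemma sum_atLeastLessThan_two: "(\<Sum>i = 0..<2::nat. f i) = f 0 + (f 1 :: 'a :: comm_monoid_add)"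
  by (simp add: numeral_2_eq_2)

lemma v2_carrier [simp]: "v2 a b \<in> carrier_vec 2" "dim_vec (v2 a b) = 2"
  by (simp_all add: v2_def)

lemma v2_index [simp]: "v2 a b $ 0 = a" "v2 a b $ Suc 0 = b"
  by (simp_all add: v2_def)

lemma m2_carrier [simp]: "m2 a b c d \<in> carrier_mat 2 2" "dim_row (m2 a b c d) = 2"
  "dim_col (m2 a b c d) = 2"
  by (simp_all add: m2_def)

lemma m2_index [simp]:
  "m2 a b c d $$ (0, 0) = a" "m2 a b c d $$ (0, Suc 0) = b"
  "m2 a b c d $$ (Suc 0, 0) = c" "m2 a b c d $$ (Suc 0, Suc 0) = d"
  by (simp_all add: m2_def)

lemma vec_two_eq_iff:
  "v \<in> carrier_vec 2 \<Longrightarrow> w \<in> carrier_vec 2 \<Longrightarrow> v = w \<longleftrightarrow> v $ 0 = w $ 0 \<and> v $ Suc 0 = w $ Suc 0"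
  by (auto intro!: eq_vecI simp: less_two_iff)

lemma mat_two_eq_iff:
  "A \<in> carrier_mat 2 2 \<Longrightarrow> B \<in> carrier_mat 2 2 \<Longrightarrow> A = B \<longleftrightarrow>
     A $$ (0, 0) = B $$ (0, 0) \<and> A $$ (0, Suc 0) = B $$ (0, Suc 0) \<and>
     A $$ (Suc 0, 0) = B $$ (Suc 0, 0) \<and> A $$ (Suc 0, Suc 0) = B $$ (Suc 0, Suc 0)"
  by (auto intro!: eq_matI simp: less_two_iff)

lemma vec_two_cases:
  assumes "v \<in> carrier_vec 2" obtains a b where "v = v2 a b"
  using that[of "v $ 0" "v $ 1"] assms by (simp add: vec_two_eq_iff)

lemma mat_two_cases:
  assumes "A \<in> carrier_mat 2 2" obtains a b c d where "A = m2 a b c d"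
  using that[of "A $$ (0, 0)" "A $$ (0, 1)" "A $$ (1, 0)" "A $$ (1, 1)"] assms
  by (simp add: mat_two_eq_iff)

lemma v2_eq_iff [simp]: "v2 a b = v2 a' b' \<longleftrightarrow> a = a' \<and> b = b'"
  by (simp add: vec_two_eq_iff)

lemma m2_eq_iff [simp]:
  "m2 a b c d = m2 a' b' c' d' \<longleftrightarrow> a = a' \<and> b = b' \<and> c = c' \<and> d = d'"
  by (simp add: mat_two_eq_iff)

lemma m2_mult_v2 [simp]: "m2 a b c d *\<^sub>v v2 x y = v2 (a * x + b * y) (c * x + d * y)"
  by (simp add: vec_two_eq_iff mult_mat_vec_def scalar_prod_def sum_atLeastLessThan_two)

lemma m2_mult [simp]:
  "m2 a b c d * m2 a' b' c' d' =
     m2 (a * a' + b * c') (a * b' + b * d') (c * a' + d * c') (c * b' + d * d')"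
  by (subst mat_two_eq_iff)
    (auto simp: scalar_prod_def sum_atLeastLessThan_two intro!: mult_carrier_mat)

lemma m2_add [simp]: "m2 a b c d + m2 a' b' c' d' = m2 (a + a') (b + b') (c + c') (d + d')"
  and m2_diff [simp]: "m2 a b c d - m2 a' b' c' d' = m2 (a - a') (b - b') (c - c') (d - d')"
  and m2_smult [simp]: "k \<cdot>\<^sub>m m2 a b c d = m2 (k * a) (k * b) (k * c) (k * d)"
  and v2_smult [simp]: "k \<cdot>\<^sub>v v2 a b = v2 (k * a) (k * b)"
  by (subst mat_two_eq_iff vec_two_eq_iff; auto simp: minus_carrier_mat)+

lemma one_mat_two: "1\<^sub>m 2 = m2 1 0 0 1"
  by (simp add: mat_two_eq_iff)

lemma unit_vec_two: "unit_vec 2 0 = v2 1 0"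
  by (simp add: vec_two_eq_iff)

lemma mat_adjoint_index [simp]:
  "i < dim_col A \<Longrightarrow> j < dim_row A \<Longrightarrow> mat_adjoint A $$ (i, j) = conjugate (A $$ (j, i))"
  by (simp add: mat_adjoint_def mat_of_rows_def)

lemma mat_adjoint_dim [simp]:
  "dim_row (mat_adjoint A) = dim_col A" "dim_col (mat_adjoint A) = dim_row A"
  by (simp_all add: mat_adjoint_def)

lemma mat_adjoint_carrier [simp]:
  "A \<in> carrier_mat n m \<Longrightarrow> mat_adjoint A \<in> carrier_mat m n"
  by (intro carrier_matI) auto

lemma mat_adjoint_m2 [simp]: "mat_adjoint (m2 a b c d) = m2 (cnj a) (cnj c) (cnj b) (cnj d)"
  by (subst mat_two_eq_iff) auto

lemma ketbra_v2 [simp]: "ketbra (v2 a b) = m2 (a * cnj a) (a * cnj b) (b * cnj a) (b * cnj b)"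
  by (subst mat_two_eq_iff) (auto simp: ketbra_def)

lemma pauli_X_m2: "pauli_X = m2 0 1 1 0" and pauli_Y_m2: "pauli_Y = m2 0 (- \<i>) \<i> 0"
  and pauli_Z_m2: "pauli_Z = m2 1 0 0 (- 1)"
  by (subst mat_two_eq_iff; auto simp: pauli_X_def pauli_Y_def pauli_Z_def mat_of_rows_list_def)+

lemma bloch_state_m2:
  "bloch_state (x, y, z) = m2 ((1 + z) / 2) ((x - \<i> * y) / 2) ((x + \<i> * y) / 2) ((1 - z) / 2)"
  by (simp add: bloch_state_def pauli_X_m2 pauli_Y_m2 pauli_Z_m2 one_mat_two)

lemma psd_mat_m2:
  "psd_mat (m2 a b c d) \<longleftrightarrow> cnj a = a \<and> cnj c = b \<and> cnj d = d \<and>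
     (\<forall>x y. 0 \<le> Re ((a * x + b * y) * cnj x + (c * x + d * y) * cnj y))"
proof -
  have "(\<forall>v \<in> carrier_vec 2. P v) \<longleftrightarrow> (\<forall>x y. P (v2 x y))" for P
    by (metis v2_carrier(1) vec_two_cases)
  then show ?thesis
    by (auto simp: psd_mat_def scalar_prod_def sum_atLeastLessThan_two square_mat.simps)
qed

text \<open>As \<open>mat_sqrt\<close> is a definite description, the main content is uniqueness of
  the positive root. Scalar matrices suffice for the trace norms evaluated below, because the square
  of a traceless Hermitian matrix of size two is scalar.\<close>

lemma mat_sqrt_scalar:
  assumes "0 \<le> r"
  shows "mat_sqrt (m2 (of_real (r\<^sup>2)) 0 0 (of_real (r\<^sup>2))) = m2 (of_real r) 0 0 (of_real r)"
  unfolding mat_sqrt_def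
proof (rule the_equality)
  show "m2 r 0 0 r \<in> carrier_mat (dim_row (m2 (of_real (r\<^sup>2)) 0 0 (of_real (r\<^sup>2))))
     (dim_row (m2 (of_real (r\<^sup>2)) 0 0 (of_real (r\<^sup>2)))) \<and> psd_mat (m2 r 0 0 r) \<and>
     m2 r 0 0 r * m2 r 0 0 r = m2 (of_real (r\<^sup>2)) 0 0 (of_real (r\<^sup>2))"
    using assms by (auto simp: psd_mat_m2 power2_eq_square mult.assoc complex_mult_cnj
      intro!: add_nonneg_nonneg mult_nonneg_nonneg)
next
  fix B assume B: "B \<in> carrier_mat (dim_row (m2 (of_real (r\<^sup>2)) 0 0 (of_real (r\<^sup>2))))
     (dim_row (m2 (of_real (r\<^sup>2)) 0 0 (of_real (r\<^sup>2)))) \<and> psd_mat B \<and>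
     B * B = m2 (of_real (r\<^sup>2)) 0 0 (of_real (r\<^sup>2))"
  then obtain a b c d where Beq: "B = m2 a b c d"
    by (auto elim: mat_two_cases)
  from B[unfolded Beq] have cb: "b = cnj c" and ad: "cnj a = a" "cnj d = d"
    and pos: "\<And>x y. 0 \<le> Re ((a * x + b * y) * cnj x + (c * x + d * y) * cnj y)"
    and sq: "a * a + b * c = r\<^sup>2" "a * b + b * d = 0" "c * b + d * d = r\<^sup>2"
    by (auto simp: psd_mat_m2)
  define p where "p = Re a"
  define q where "q = Re d"
  have a: "a = of_real p" and d: "d = of_real q"
    using ad by (auto simp: p_def q_def complex_eq_iff)
  have p0: "p \<ge> 0" and q0: "q \<ge> 0"
    using pos[of 1 0] pos[of 0 1] by (auto simp: p_def q_def)
  \<comment> \<open>A nonzero \<open>c\<close> would force \<open>a + d = 0\<close>, hence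
    \<open>a = d = 0\<close> since both are nonnegative reals; the quadratic form at the vector
    \<open>(1, - c)\<close> would then be negative.\<close>
  have c0: "c = 0"
  proof (rule ccontr)
    assume c: "c \<noteq> 0"
    with sq(2) cb have "a + d = 0"
      by (simp add: algebra_simps) (metis complex_cnj_zero_iff mult_cancel_left distrib_left
          mult.commute mult_eq_0_iff)
    then have "p + q = 0" by (metis a d of_real_add of_real_eq_0_iff)
    then have "p = 0" "q = 0" using p0 q0 by auto
    with a d have "a = 0" "d = 0" by auto
    then have "0 \<le> - Re (c * cnj c) * 2" using pos[of 1 "- c"] cb by (simp add: algebra_simps)
    moreover have "Re (c * cnj c) > 0" using c by (auto simp: complex_eq_iff sum_squares_gt_zero_iff)
    ultimately show False by linarith
  qed
  with sq cb a d have "complex_of_real (p * p) = of_real (r\<^sup>2)"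
    "complex_of_real (q * q) = of_real (r\<^sup>2)"
    by simp_all
  then have "p * p = r\<^sup>2" "q * q = r\<^sup>2"
    by (simp_all only: of_real_eq_iff)
  then have "p = r" "q = r" using assms p0 q0 by (metis power2_eq_square power2_eq_imp_eq)+
  then show "B = m2 r 0 0 r" using c0 cb a d Beq by simp
qed

section \<open>Trace norm and hybrid argument\<close>

text \<open>The eigenvalues of \<open>A\<close> are \<open>r\<close> and \<open>- r\<close>, where
  the square of \<open>r\<close> is the sum of the squared moduli of the entries in the first row,
  so the trace norm equals \<open>2 * r\<close>. The bound turns the accuracy requirement into one
  on a single measurement probability.\<close>

lemma trace_norm_traceless_ge:
  assumes A: "A \<in> carrier_mat 2 2" "mat_adjoint A = A" "mat_trace A = 0"
  shows "2 * \<bar>Re (A $$ (0, 0))\<bar> \<le> trace_norm A"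
proof -
  obtain a b c d where eq: "A = m2 a b c d" using A(1) by (rule mat_two_cases)
  have *: "cnj a = a" "cnj c = b" "d = - a"
    using A(2,3) by (auto simp: eq mat_trace_def sum_lessThan_two add_eq_0_iff)
  then have a: "a = of_real (Re a)" by (simp add: complex_eq_iff)
  define r where "r = sqrt ((Re a)\<^sup>2 + (cmod b)\<^sup>2)"
  have r2: "r\<^sup>2 = (Re a)\<^sup>2 + (cmod b)\<^sup>2" by (simp add: r_def)
  have "c * cnj c = of_real ((cmod b)\<^sup>2)"
    using *(2) by (metis complex_mod_cnj complex_norm_square)
  moreover have "a * a = of_real ((Re a)\<^sup>2)" by (subst (1 2) a) (simp add: power2_eq_square)
  ultimately have "mat_adjoint A * A = m2 (of_real (r\<^sup>2)) 0 0 (of_real (r\<^sup>2))"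
    using * unfolding eq r2 by (auto simp: algebra_simps)
  then have "trace_norm A = 2 * r"
    using mat_sqrt_scalar[of r]
    by (simp add: trace_norm_def mat_trace_def sum_lessThan_two r_def)
  moreover have "\<bar>Re a\<bar> \<le> r" unfolding r_def by (intro real_le_rsqrt) simp
  ultimately show ?thesis by (simp add: eq)
qed

lemma trace_norm_zero: "trace_norm (0\<^sub>m 2 2) = 0"
proof -
  have "0\<^sub>m 2 2 = m2 0 0 0 0" by (simp add: mat_two_eq_iff)
  then show ?thesis
    using mat_sqrt_scalar[of 0] by (simp add: trace_norm_def mat_trace_def sum_lessThan_two)
qed

section \<open>Euclidean norm of state vectors\<close>

definition vnorm :: "complex vec \<Rightarrow> real" where
  "vnorm v = L2_set (\<lambda>i. cmod (v $ i)) {..<dim_vec v}"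

lemma vnorm_power2: "(vnorm v)\<^sup>2 = (\<Sum>i<dim_vec v. (cmod (v $ i))\<^sup>2)"
  by (simp add: vnorm_def L2_set_def sum_nonneg)

lemma vnorm_nonneg [simp]: "0 \<le> vnorm v"
  by (simp add: vnorm_def)

lemma vnorm_add_le:
  assumes "dim_vec v = dim_vec w"
  shows "vnorm (v + w) \<le> vnorm v + vnorm w"
proof -
  have "vnorm (v + w) \<le> L2_set (\<lambda>i. cmod (v $ i) + cmod (w $ i)) {..<dim_vec w}"
    unfolding vnorm_def using assms by (auto intro!: L2_set_mono norm_triangle_ineq)
  also have "\<dots> \<le> vnorm v + vnorm w"
    unfolding vnorm_def assms by (rule L2_set_triangle_ineq)
  finally show ?thesis .
qed

lemma vnorm_smult: "vnorm (c \<cdot>\<^sub>v v) = cmod c * vnorm v"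
  by (auto simp: vnorm_def norm_mult L2_set_right_distrib intro!: L2_set_cong)

lemma vnorm_cscalar: "v \<bullet>c v = of_real ((vnorm v)\<^sup>2)"
  unfolding vnorm_power2 scalar_prod_def
  by (simp add: complex_norm_square lessThan_atLeast0 del: of_real_power)

lemma smult_mat_mult_vec:
  "dim_col A = dim_vec v \<Longrightarrow> (c \<cdot>\<^sub>m A) *\<^sub>v v = c \<cdot>\<^sub>v (A *\<^sub>v (v :: 'a :: comm_ring_1 vec))"
  by (intro eq_vecI) auto

lemma mat_adjoint_cscalar:
  fixes A :: "complex mat"
  assumes "A \<in> carrier_mat n m" "u \<in> carrier_vec n" "v \<in> carrier_vec m"
  shows "(mat_adjoint A *\<^sub>v u) \<bullet>c v = u \<bullet>c (A *\<^sub>v v)"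
proof -
  have "(mat_adjoint A *\<^sub>v u) \<bullet>c v = (\<Sum>i = 0..<m. \<Sum>j = 0..<n. cnj (A $$ (j, i)) * u $ j * cnj (v $ i))"
    using assms by (auto simp: scalar_prod_def sum_distrib_right intro!: sum.cong)
  also have "\<dots> = (\<Sum>j = 0..<n. \<Sum>i = 0..<m. cnj (A $$ (j, i)) * u $ j * cnj (v $ i))"
    by (rule sum.swap)
  also have "\<dots> = u \<bullet>c (A *\<^sub>v v)"
    using assms by (auto simp: scalar_prod_def sum_distrib_left mult_ac intro!: sum.cong)
  finally show ?thesis .
qed

text \<open>Moving \<open>W\<close> across the inner product leaves its adjoint times
  \<open>W\<close>. The scale \<open>r\<close> is kept because the difference of two oracles will be
  a multiple of a unitary; \<open>r = 1\<close> gives unitaries themselves.\<close>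

lemma vnorm_scaled_isometry:
  assumes W: "W \<in> carrier_mat n n" "mat_adjoint W * W = of_real (r\<^sup>2) \<cdot>\<^sub>m 1\<^sub>m n" "0 \<le> r"
    and v: "v \<in> carrier_vec n"
  shows "vnorm (W *\<^sub>v v) = r * vnorm v"
proof -
  have "of_real ((vnorm (W *\<^sub>v v))\<^sup>2) = (mat_adjoint W *\<^sub>v (W *\<^sub>v v)) \<bullet>c v"
    using W v by (simp add: vnorm_cscalar[symmetric] mat_adjoint_cscalar del: of_real_power)
  also have "mat_adjoint W *\<^sub>v (W *\<^sub>v v) = of_real (r\<^sup>2) \<cdot>\<^sub>v v"
    using W v by (simp add: assoc_mult_mat_vec[symmetric, of _ n n] smult_mat_mult_vec del:
        of_real_power)
  also have "\<dots> \<bullet>c v = of_real ((r * vnorm v)\<^sup>2)"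
    using v by (simp add: vnorm_cscalar power_mult_distrib)
  finally have "(vnorm (W *\<^sub>v v))\<^sup>2 = (r * vnorm v)\<^sup>2"
    by (simp only: of_real_eq_iff)
  then show ?thesis using W(3) by simp
qed

lemma vnorm_unitary:
  assumes "unitary_mat n W" "v \<in> carrier_vec n"
  shows "vnorm (W *\<^sub>v v) = vnorm v"
proof -
  have "(1 :: complex) \<cdot>\<^sub>m 1\<^sub>m n = 1\<^sub>m n" by (intro eq_matI) auto
  then show ?thesis
    using vnorm_scaled_isometry[of W n 1 v] assms by (simp add: unitary_mat_def)
qed

section \<open>Single-qubit operators on a register\<close>

lemma set_bit_less_exp:
  fixes i :: nat
  assumes "i < 2 ^ n" "k < n"
  shows "set_bit k i < 2 ^ n"
proof -
  have "take_bit n (set_bit k i) = set_bit k i"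
    using assms by (simp add: take_bit_set_bit_eq take_bit_nat_eq_self)
  then show ?thesis by (metis take_bit_nat_less_exp)
qed

lemma unset_bit_less_exp:
  fixes i :: nat
  assumes "i < 2 ^ n"
  shows "unset_bit k i < 2 ^ n"
proof -
  have "take_bit n (unset_bit k i) = unset_bit k i"
    using assms
    by (metis bit_take_bit_iff bit_unset_bit_iff bit_eq_iff take_bit_nat_eq_self)
  then show ?thesis by (metis take_bit_nat_less_exp)
qed

text \<open>Locates the entries of \<open>on_qubit\<close>: in row \<open>i\<close> only the columns
  \<open>unset_bit k i\<close> and \<open>set_bit k i\<close> can be nonzero.\<close>

lemma unset_bit_eq_iff:
  fixes i j :: nat
  shows "unset_bit k i = unset_bit k j \<longleftrightarrow> j = unset_bit k i \<or> j = set_bit k i"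
proof
  assume "unset_bit k i = unset_bit k j"
  then have *: "m \<noteq> k \<Longrightarrow> bit i m = bit j m" for m
    by (metis bit_unset_bit_iff)
  show "j = unset_bit k i \<or> j = set_bit k i"
  proof (cases "bit j k")
    case True
    then have "j = set_bit k i" using * by (intro bit_eqI) (metis bit_set_bit_iff possible_bit_nat)
    then show ?thesis ..
  next
    case False
    then have "j = unset_bit k i" using * by (intro bit_eqI) (metis bit_unset_bit_iff)
    then show ?thesis ..
  qed
next
  assume "j = unset_bit k i \<or> j = set_bit k i"
  then show "unset_bit k i = unset_bit k j" by (auto intro!: bit_eqI simp: bit_simps)
qed

text \<open>Basis indices are grouped into pairs that differ in digit \<open>k\<close> only, each
  represented by the member whose digit is 0. The span of such a pair is invariant under
  \<open>on_qubit\<close>.\<close>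

lemma sum_pair_bit:
  fixes f :: "nat \<Rightarrow> 'a :: comm_monoid_add"
  assumes "k < n"
  shows "(\<Sum>i<2 ^ n. f i) = (\<Sum>i :: nat | i < 2 ^ n \<and> \<not> bit i k. f i + f (set_bit k i))"
proof -
  let ?S = "{i :: nat. i < 2 ^ n \<and> \<not> bit i k}" and ?T = "{i :: nat. i < 2 ^ n \<and> bit i k}"
  have "bij_betw (set_bit k) ?S ?T"
  proof (rule bij_betw_byWitness[where f' = "unset_bit k"])
    show "\<forall>i\<in>?S. unset_bit k (set_bit k i) = i" "\<forall>i\<in>?T. set_bit k (unset_bit k i) = i"
      by (auto intro!: bit_eqI simp: bit_simps)
    show "set_bit k ` ?S \<subseteq> ?T" using assms by (auto simp: set_bit_less_exp bit_simps)
    show "unset_bit k ` ?T \<subseteq> ?S"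
      by (auto simp: bit_simps unset_bit_less_exp)
  qed
  then have "(\<Sum>i\<in>?S. f (set_bit k i)) = (\<Sum>i\<in>?T. f i)"
    by (rule sum.reindex_bij_betw)
  moreover have "{..<2 ^ n} = ?S \<union> ?T" by auto
  moreover have "(\<Sum>i\<in>?S \<union> ?T. f i) = (\<Sum>i\<in>?S. f i) + (\<Sum>i\<in>?T. f i)"
    by (rule sum.union_disjoint) auto
  ultimately show ?thesis by (simp add: sum.distrib)
qed

lemma on_qubit_carrier [simp]: "on_qubit n k M \<in> carrier_mat (2 ^ n) (2 ^ n)"
  by (simp add: on_qubit_def)

lemma on_qubit_dim [simp]:
  "dim_row (on_qubit n k M) = 2 ^ n" "dim_col (on_qubit n k M) = 2 ^ n"
  by (simp_all add: on_qubit_def)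

lemma on_qubit_mult_index:
  assumes "k < n" "v \<in> carrier_vec (2 ^ n)" "i < 2 ^ n" "\<not> bit i k"
  shows "(on_qubit n k (m2 a b c d) *\<^sub>v v) $ i = a * v $ i + b * v $ set_bit k i"
    and "(on_qubit n k (m2 a b c d) *\<^sub>v v) $ set_bit k i = c * v $ i + d * v $ set_bit k i"
proof -
  have i: "unset_bit k i = i" using assms(4) by (auto intro!: bit_eqI simp: bit_simps)
  have i': "unset_bit k (set_bit k i) = i" "set_bit k (set_bit k i) = set_bit k i"
    using assms(4) by (auto intro!: bit_eqI simp: bit_simps)
  have ne: "set_bit k i \<noteq> i" using assms(4) by (metis bit_set_bit_iff possible_bit_nat)
  note less = set_bit_less_exp[OF assms(3,1)]
  have sum: "(\<Sum>j = 0..<2 ^ n. (if j = i \<or> j = set_bit k i then f j else 0)) = f i + f (set_bit k i)"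
    for f :: "nat \<Rightarrow> complex"
  proof -
    have "(\<Sum>j = 0..<2 ^ n. (if j = i \<or> j = set_bit k i then f j else 0)) = (\<Sum>j\<in>{i, set_bit k i}. f j)"
      using assms(3) less by (intro sum.mono_neutral_cong_right) auto
    then show ?thesis using ne by simp
  qed
  have "(on_qubit n k (m2 a b c d) *\<^sub>v v) $ i =
     (\<Sum>j = 0..<2 ^ n. if j = i \<or> j = set_bit k i then m2 a b c d $$ (0, of_bool (bit j k)) * v $ j
         else 0)"
    using assms i unset_bit_eq_iff[of k i] by (auto simp: on_qubit_def scalar_prod_def intro!: sum.cong)
  also have "\<dots> = a * v $ i + b * v $ set_bit k i"
    unfolding sum using assms(4) by (simp add: bit_simps)
  finally show "(on_qubit n k (m2 a b c d) *\<^sub>v v) $ i = a * v $ i + b * v $ set_bit k i" .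
  have "(on_qubit n k (m2 a b c d) *\<^sub>v v) $ set_bit k i =
     (\<Sum>j = 0..<2 ^ n. if j = i \<or> j = set_bit k i then m2 a b c d $$ (Suc 0, of_bool (bit j k)) * v $
         j else 0)"
    using assms i' less unset_bit_eq_iff[of k "set_bit k i"]
    by (auto simp: on_qubit_def scalar_prod_def bit_simps intro!: sum.cong)
  also have "\<dots> = c * v $ i + d * v $ set_bit k i"
    unfolding sum using assms(4) by (simp add: bit_simps)
  finally show "(on_qubit n k (m2 a b c d) *\<^sub>v v) $ set_bit k i = c * v $ i + d * v $ set_bit k i" .
qed

text \<open>On each pair of basis states differing in digit \<open>k\<close> the operator acts as
  \<open>M\<close> itself, so the two-dimensional scaling \<open>pair\<close> adds up over all
  pairs.\<close>

lemma vnorm_on_qubit: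
  assumes M: "M \<in> carrier_mat 2 2" "mat_adjoint M * M = of_real (r\<^sup>2) \<cdot>\<^sub>m 1\<^sub>m 2" "0 \<le> r"
    and "k < n" "v \<in> carrier_vec (2 ^ n)"
  shows "vnorm (on_qubit n k M *\<^sub>v v) = r * vnorm v"
proof -
  obtain a b c d where Meq: "M = m2 a b c d" using M(1) by (rule mat_two_cases)
  have pair: "(cmod (a * x + b * y))\<^sup>2 + (cmod (c * x + d * y))\<^sup>2 = r\<^sup>2 * ((cmod x)\<^sup>2 + (cmod y)\<^sup>2)"
      for x y
  proof -
    have v2: "(vnorm (v2 x y))\<^sup>2 = (cmod x)\<^sup>2 + (cmod y)\<^sup>2" for x y
      by (simp add: vnorm_power2 sum_lessThan_two)
    have "vnorm (M *\<^sub>v v2 x y) = r * vnorm (v2 x y)"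
      using M by (intro vnorm_scaled_isometry) auto
    then have "(vnorm (M *\<^sub>v v2 x y))\<^sup>2 = r\<^sup>2 * (vnorm (v2 x y))\<^sup>2" by (simp add: power_mult_distrib)
    then show ?thesis by (simp add: Meq v2)
  qed
  have "(vnorm (on_qubit n k M *\<^sub>v v))\<^sup>2 = (\<Sum>i<2 ^ n. (cmod ((on_qubit n k M *\<^sub>v v) $ i))\<^sup>2)"
    by (simp add: vnorm_power2 on_qubit_def)
  also have "\<dots> = (\<Sum>i | i < 2 ^ n \<and> \<not> bit i k.
      (cmod (a * v $ i + b * v $ set_bit k i))\<^sup>2 + (cmod (c * v $ i + d * v $ set_bit k i))\<^sup>2)"
    unfolding sum_pair_bit[OF \<open>k < n\<close>] Meq
    by (intro sum.cong) (auto simp: on_qubit_mult_index[OF assms(4,5)] simp del: index_mult_mat_vec)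
  also have "\<dots> = r\<^sup>2 * (\<Sum>i | i < 2 ^ n \<and> \<not> bit i k. (cmod (v $ i))\<^sup>2 + (cmod (v $ set_bit k i))\<^sup>2)"
    unfolding pair sum_distrib_left ..
  also have "\<dots> = (r * vnorm v)\<^sup>2"
    using assms(5)
    by (simp only: sum_pair_bit[OF \<open>k < n\<close>, of "\<lambda>i. (cmod (v $ i))\<^sup>2", symmetric] vnorm_power2
        power_mult_distrib carrier_vecD)
  finally show ?thesis using M(3) by simp
qed

lemma on_qubit_add_smult:
  assumes "A \<in> carrier_mat 2 2" "B \<in> carrier_mat 2 2"
  shows "on_qubit n k (A + c \<cdot>\<^sub>m B) = on_qubit n k A + c \<cdot>\<^sub>m on_qubit n k B"
  using assms by (intro eq_matI) (auto simp: on_qubit_def)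

section \<open>Comparison of runs with two different oracles\<close>

lemma unitary_mat_adjoint: "unitary_mat 2 U \<Longrightarrow> unitary_mat 2 (mat_adjoint U)"
  by (auto simp: unitary_mat_def elim!: mat_two_cases)

definition query_mat :: "complex mat \<Rightarrow> bool \<Rightarrow> complex mat" where
  "query_mat U b = (if b then mat_adjoint U else U)"

lemma query_mat_unitary: "unitary_mat 2 U \<Longrightarrow> unitary_mat 2 (query_mat U b)"
  by (simp add: query_mat_def unitary_mat_adjoint)

lemma run_step_alt: "run_step n U (b, k, W) v = W *\<^sub>v (on_qubit n k (query_mat U b) *\<^sub>v v)"
  by (simp add: run_step_def query_mat_def)

lemma run_step_isometry:
  assumes "unitary_mat 2 U" "v \<in> carrier_vec (2 ^ n)" "k < n" "unitary_mat (2 ^ n) W"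
  shows "run_step n U (b, k, W) v \<in> carrier_vec (2 ^ n) \<and> vnorm (run_step n U (b, k, W) v) = vnorm v"
proof -
  have "vnorm (on_qubit n k (query_mat U b) *\<^sub>v v) = 1 * vnorm v"
    using assms query_mat_unitary[OF assms(1), of b]
    by (intro vnorm_on_qubit) (auto simp: unitary_mat_def)
  moreover have "on_qubit n k (query_mat U b) *\<^sub>v v \<in> carrier_vec (2 ^ n)"
    using assms(2) by (intro mult_mat_vec_carrier[of _ _ "2 ^ n"]) auto
  ultimately show ?thesis
    using assms vnorm_unitary[OF assms(4)] unfolding run_step_alt
    by (auto simp: unitary_mat_def intro!: mult_mat_vec_carrier)
qed

abbreviation wf_steps :: "nat \<Rightarrow> (bool \<times> nat \<times> complex mat) list \<Rightarrow> bool" where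
  "wf_steps n S \<equiv> \<forall>(b, k, W) \<in> set S. k < n \<and> unitary_mat (2 ^ n) W"

lemma fold_run_step_isometry:
  assumes "unitary_mat 2 U" "v \<in> carrier_vec (2 ^ n)" "wf_steps n S"
  shows "fold (run_step n U) S v \<in> carrier_vec (2 ^ n) \<and> vnorm (fold (run_step n U) S v) = vnorm v"
  using assms(2,3)
proof (induction S arbitrary: v)
  case (Cons a S)
  obtain b k W where a: "a = (b, k, W)" by (cases a)
  from Cons run_step_isometry[OF assms(1), of v n k W b] show ?case by (auto simp: a)
qed simp

text \<open>Global phases of the oracles do not affect the output, so the two runs are compared up to a phase.\<close>

lemma run_step_hybrid:
  assumes U: "unitary_mat 2 U" and V: "unitary_mat 2 V" and wf: "k < n" "unitary_mat (2 ^ n) W"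
    and M: "M \<in> carrier_mat 2 2" "mat_adjoint M * M = of_real (\<delta>\<^sup>2) \<cdot>\<^sub>m 1\<^sub>m 2" "0 \<le> \<delta>"
    and eq: "query_mat U b = M + e \<cdot>\<^sub>m query_mat V b" and p: "cmod p = 1"
    and x: "x \<in> carrier_vec (2 ^ n)" and w: "w \<in> carrier_vec (2 ^ n)" "vnorm w = 1"
  obtains x' where "x' \<in> carrier_vec (2 ^ n)" "vnorm x' \<le> vnorm x + \<delta>"
    "run_step n U (b, k, W) (x + p \<cdot>\<^sub>v w) = x' + (p * e) \<cdot>\<^sub>v run_step n V (b, k, W) w"
proof -
  let ?U = "on_qubit n k (query_mat U b)" and ?V = "on_qubit n k (query_mat V b)"
  let ?M = "on_qubit n k M"
  have carr: "?U \<in> carrier_mat (2 ^ n) (2 ^ n)" "?V \<in> carrier_mat (2 ^ n) (2 ^ n)"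
    "?M \<in> carrier_mat (2 ^ n) (2 ^ n)" by simp_all
  have Wc: "W \<in> carrier_mat (2 ^ n) (2 ^ n)" using wf by (simp add: unitary_mat_def)
  have UV: "query_mat V b \<in> carrier_mat 2 2"
    using query_mat_unitary[OF V, of b] by (simp add: unitary_mat_def)
  \<comment> \<open>The new error vector: the old error after the query, plus the part of the query
    on \<open>w\<close> that is not \<open>e\<close> times the query to the other oracle.\<close>
  define y where "y = ?U *\<^sub>v x + p \<cdot>\<^sub>v (?M *\<^sub>v w)"
  have cv: "?U *\<^sub>v x \<in> carrier_vec (2 ^ n)" "?M *\<^sub>v w \<in> carrier_vec (2 ^ n)"
    "?V *\<^sub>v w \<in> carrier_vec (2 ^ n)"
    using x w carr by (auto intro!: mult_mat_vec_carrier)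
  have y: "y \<in> carrier_vec (2 ^ n)" using cv by (simp add: y_def)
  have "?U = ?M + e \<cdot>\<^sub>m ?V" unfolding eq using M UV by (simp add: on_qubit_add_smult)
  then have "?U *\<^sub>v w = ?M *\<^sub>v w + e \<cdot>\<^sub>v (?V *\<^sub>v w)"
    using carr w by (simp add: add_mult_distrib_mat_vec[of _ "2 ^ n" "2 ^ n"] smult_mat_mult_vec)
  then have "?U *\<^sub>v (x + p \<cdot>\<^sub>v w) = ?U *\<^sub>v x + p \<cdot>\<^sub>v (?M *\<^sub>v w + e \<cdot>\<^sub>v (?V *\<^sub>v w))"
    using carr x w by (simp add: mult_add_distrib_mat_vec[of _ "2 ^ n" "2 ^ n"] mult_mat_vec[of _ "2
        ^ n" "2 ^ n"])
  also have "\<dots> = y + (p * e) \<cdot>\<^sub>v (?V *\<^sub>v w)"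
    using cv by (intro eq_vecI) (auto simp: y_def algebra_simps)
  finally have "run_step n U (b, k, W) (x + p \<cdot>\<^sub>v w) = W *\<^sub>v y + (p * e) \<cdot>\<^sub>v run_step n V (b, k, W) w"
    unfolding run_step_alt using Wc y cv
    by (simp add: mult_add_distrib_mat_vec[of _ "2 ^ n" "2 ^ n"] mult_mat_vec[of _ "2 ^ n" "2 ^ n"])
  moreover have "W *\<^sub>v y \<in> carrier_vec (2 ^ n)" using Wc y by (rule mult_mat_vec_carrier)
  moreover have "vnorm (W *\<^sub>v y) \<le> vnorm x + \<delta>"
  proof -
    have "vnorm (W *\<^sub>v y) = vnorm y" using vnorm_unitary[OF wf(2) y] .
    also have "\<dots> \<le> vnorm (?U *\<^sub>v x) + vnorm (p \<cdot>\<^sub>v (?M *\<^sub>v w))"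
      unfolding y_def using cv by (intro vnorm_add_le) auto
    also have "vnorm (?U *\<^sub>v x) = 1 * vnorm x"
      using query_mat_unitary[OF U, of b] x wf by (intro vnorm_on_qubit) (auto simp: unitary_mat_def)
    also have "vnorm (p \<cdot>\<^sub>v (?M *\<^sub>v w)) = \<delta>"
      using vnorm_on_qubit[OF M wf(1) w(1)] w(2) p by (simp add: vnorm_smult)
    finally show ?thesis by simp
  qed
  ultimately show thesis using that by blast
qed

text \<open>The reference run \<open>w\<close> stays normalised, so every query adds at most
  \<open>\<delta>\<close> to the error \<open>x\<close>, while the phases \<open>e\<close> multiply
  up in \<open>p'\<close>. The assumption \<open>near\<close> ranges over \<open>b\<close> because
  inverse queries have their own \<open>M\<close> and \<open>e\<close>.\<close>

lemma fold_run_step_hybrid: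
  assumes U: "unitary_mat 2 U" and V: "unitary_mat 2 V" and "wf_steps n S" "0 \<le> \<delta>"
    and near: "\<And>b. \<exists>M e. cmod e = 1 \<and> M \<in> carrier_mat 2 2 \<and>
       mat_adjoint M * M = of_real (\<delta>\<^sup>2) \<cdot>\<^sub>m 1\<^sub>m 2 \<and> query_mat U b = M + e \<cdot>\<^sub>m query_mat V b"
    and "cmod p = 1" "x \<in> carrier_vec (2 ^ n)" "w \<in> carrier_vec (2 ^ n)" "vnorm w = 1"
  shows "\<exists>x' p'. cmod p' = 1 \<and> x' \<in> carrier_vec (2 ^ n) \<and> vnorm x' \<le> vnorm x + \<delta> * length S \<and>
    fold (run_step n U) S (x + p \<cdot>\<^sub>v w) = x' + p' \<cdot>\<^sub>v fold (run_step n V) S w"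
  using assms(3) assms(6-9)
proof (induction S arbitrary: x p w)
  case Nil
  then show ?case by auto
next
  case (Cons a S)
  obtain b k W where a: "a = (b, k, W)" by (cases a)
  obtain M e where M: "cmod e = 1" "M \<in> carrier_mat 2 2"
    "mat_adjoint M * M = of_real (\<delta>\<^sup>2) \<cdot>\<^sub>m 1\<^sub>m 2" "query_mat U b = M + e \<cdot>\<^sub>m query_mat V b"
    using near by blast
  have wf: "k < n" "unitary_mat (2 ^ n) W" using Cons.prems(1) a by auto
  obtain x' where x': "x' \<in> carrier_vec (2 ^ n)" "vnorm x' \<le> vnorm x + \<delta>"
    "run_step n U (b, k, W) (x + p \<cdot>\<^sub>v w) = x' + (p * e) \<cdot>\<^sub>v run_step n V (b, k, W) w"
    using run_step_hybrid[OF U V wf M(2,3) assms(4) M(4) Cons.prems(2-5)] .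
  have "run_step n V (b, k, W) w \<in> carrier_vec (2 ^ n) \<and> vnorm (run_step n V (b, k, W) w) = 1"
    using run_step_isometry[OF V Cons.prems(4) wf] Cons.prems(5) by simp
  then obtain x'' p' where "cmod p' = 1" "x'' \<in> carrier_vec (2 ^ n)" "vnorm x'' \<le> vnorm x' + \<delta> *
      length S"
    "fold (run_step n U) S (x' + (p * e) \<cdot>\<^sub>v run_step n V (b, k, W) w) =
       x'' + p' \<cdot>\<^sub>v fold (run_step n V) S (run_step n V (b, k, W) w)"
    using Cons.IH[of "p * e" x' "run_step n V (b, k, W) w"] Cons.prems M(1) x'(1)
    by (auto simp: norm_mult)
  then show ?case
    using x' by (intro exI[of _ x''] exI[of _ p']) (auto simp: a algebra_simps)
qed

section \<open>Reduced state of the system qubit\<close>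

lemma sum_double: "(\<Sum>i<2 * m :: nat. f i) = (\<Sum>k<m. f (2 * k) + f (2 * k + 1) :: 'a :: comm_monoid_add)"
  by (induction m) (simp_all add: add.assoc)

lemma system_state_carrier [simp]: "system_state n v \<in> carrier_mat 2 2"
  by (simp add: system_state_def)

lemma system_state_adjoint: "mat_adjoint (system_state n v) = system_state n v"
  by (subst mat_two_eq_iff) (auto simp: system_state_def cnj_sum mult.commute)

lemma system_state_trace:
  assumes "n \<ge> 1" "v \<in> carrier_vec (2 ^ n)"
  shows "mat_trace (system_state n v) = of_real ((vnorm v)\<^sup>2)"
proof -
  have "(2 :: nat) ^ n = 2 * 2 ^ (n - 1)" using assms(1) by (simp flip: power_Suc)
  then have "(vnorm v)\<^sup>2 = (\<Sum>k<2 ^ (n - 1). (cmod (v $ (2 * k)))\<^sup>2 + (cmod (v $ (2 * k + 1)))\<^sup>2)"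
    using assms(2) by (simp add: vnorm_power2 sum_double)
  then have "of_real ((vnorm v)\<^sup>2) = (\<Sum>k<2 ^ (n - 1). v $ (2 * k) * cnj (v $ (2 * k)) +
      v $ (2 * k + 1) * cnj (v $ (2 * k + 1)))"
    by (simp add: complex_norm_square del: of_real_power)
  then show ?thesis
    by (simp add: mat_trace_def system_state_def sum_lessThan_two sum.distrib del: of_real_power)
qed

text \<open>Entrywise, a difference of squared moduli is the sum times the difference of the moduli,
  and the latter is at most the modulus of the entry of \<open>x\<close>, because \<open>p\<close>
  has modulus one. Cauchy-Schwarz then gives the bound
  \<open>(vnorm v + vnorm w) * vnorm x\<close>.\<close>

lemma system_state_00_diff_le:
  assumes n: "n \<ge> 1" and v: "v \<in> carrier_vec (2 ^ n)" "vnorm v = 1"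
    and w: "w \<in> carrier_vec (2 ^ n)" "vnorm w = 1"
    and x: "x \<in> carrier_vec (2 ^ n)" "v = x + p \<cdot>\<^sub>v w" and p: "cmod p = 1"
  shows "Re (system_state n v $$ (0, 0)) - Re (system_state n w $$ (0, 0)) \<le> 2 * vnorm x"
proof -
  have n2: "(2 :: nat) ^ n = 2 * 2 ^ (n - 1)" using n by (simp flip: power_Suc)
  have 00: "Re (system_state n v $$ (0, 0)) = (\<Sum>k<2 ^ (n - 1). (cmod (v $ (2 * k)))\<^sup>2)" for v
    by (auto simp: system_state_def cmod_power2 power2_eq_square[of "Re _"] power2_eq_square[of "Im
        _"] intro!: sum.cong)
  have le: "(cmod (v $ i))\<^sup>2 - (cmod (w $ i))\<^sup>2 \<le> \<bar>cmod (v $ i) + cmod (w $ i)\<bar> * \<bar>cmod (x $ i)\<bar>"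
    if "i < 2 ^ n" for i
  proof -
    have "v $ i = x $ i + p * w $ i" using that x w by simp
    then have "cmod (v $ i) - cmod (w $ i) \<le> cmod (x $ i)"
      using norm_triangle_ineq[of "x $ i" "p * w $ i"] p by (simp add: norm_mult)
    then have "(cmod (v $ i) + cmod (w $ i)) * (cmod (v $ i) - cmod (w $ i))
        \<le> (cmod (v $ i) + cmod (w $ i)) * cmod (x $ i)"
      by (intro mult_left_mono) auto
    then show ?thesis by (simp add: power2_eq_square algebra_simps)
  qed
  have "Re (system_state n v $$ (0, 0)) - Re (system_state n w $$ (0, 0)) =
      (\<Sum>k<2 ^ (n - 1). (cmod (v $ (2 * k)))\<^sup>2 - (cmod (w $ (2 * k)))\<^sup>2)"
    by (simp add: 00 sum_subtractf)
  \<comment> \<open>Nonnegative terms for the odd indices are added to obtain a sum over the whole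
    register.\<close>
  also have "\<dots> \<le> (\<Sum>k<2 ^ (n - 1). \<bar>cmod (v $ (2 * k)) + cmod (w $ (2 * k))\<bar> * \<bar>cmod (x $ (2 * k))\<bar> +
      \<bar>cmod (v $ (2 * k + 1)) + cmod (w $ (2 * k + 1))\<bar> * \<bar>cmod (x $ (2 * k + 1))\<bar>)"
    using n2 by (intro sum_mono order_trans[OF le]) auto
  also have "\<dots> = (\<Sum>i<2 ^ n. \<bar>cmod (v $ i) + cmod (w $ i)\<bar> * \<bar>cmod (x $ i)\<bar>)"
    unfolding n2 sum_double ..
  also have "\<dots> \<le> L2_set (\<lambda>i. cmod (v $ i) + cmod (w $ i)) {..<2 ^ n} * L2_set (\<lambda>i. cmod (x $ i))
      {..<2 ^ n}"
    by (rule L2_set_mult_ineq)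
  also have "\<dots> \<le> (vnorm v + vnorm w) * vnorm x"
    using v(1) w(1) x(1) L2_set_triangle_ineq[of "\<lambda>i. cmod (v $ i)" "\<lambda>i. cmod (w $ i)" "{..<2 ^ n}"]
    by (intro mult_mono) (auto simp: vnorm_def)
  finally show ?thesis using v w by simp
qed

text \<open>Both runs start in the same state, that is with error zero and phase one, so the error
  ends with norm at most \<open>\<delta> * num_queries C\<close>. The factor 2 comes from passing to
  squared amplitudes.\<close>

lemma circuit_output_diff_le:
  assumes wf: "wf_circuit C" and U: "unitary_mat 2 U" and V: "unitary_mat 2 V" and "0 \<le> \<delta>"
    and near: "\<And>b. \<exists>M e. cmod e = 1 \<and> M \<in> carrier_mat 2 2 \<and>
       mat_adjoint M * M = of_real (\<delta>\<^sup>2) \<cdot>\<^sub>m 1\<^sub>m 2 \<and> query_mat U b = M + e \<cdot>\<^sub>m query_mat V b"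
  shows "Re (circuit_output C U $$ (0, 0)) - Re (circuit_output C V $$ (0, 0)) \<le> 2 * \<delta> * num_queries C"
proof -
  define n where "n = n_qubits C"
  define w where "w = first_gate C *\<^sub>v init_state C"
  have n: "n \<ge> 1" and steps: "wf_steps n (query_steps C)"
    and init: "init_state C \<in> carrier_vec (2 ^ n)" "init_state C \<bullet>c init_state C = 1"
    and fg: "unitary_mat (2 ^ n) (first_gate C)"
    using wf by (auto simp: wf_circuit_def n_def)
  have "(vnorm (init_state C))\<^sup>2 = 1"
    using init(2) vnorm_cscalar[of "init_state C"] by (simp only: of_real_eq_1_iff)
  then have "vnorm (init_state C) = 1" using vnorm_nonneg by (metis abs_of_nonneg abs_square_eq_1)
  then have w: "w \<in> carrier_vec (2 ^ n)" "vnorm w = 1"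
    using vnorm_unitary[OF fg init(1)] fg init
    by (auto simp: w_def unitary_mat_def intro!: mult_mat_vec_carrier)
  have "\<exists>x' p'. cmod p' = 1 \<and> x' \<in> carrier_vec (2 ^ n) \<and>
      vnorm x' \<le> vnorm (0\<^sub>v (2 ^ n)) + \<delta> * length (query_steps C) \<and>
    fold (run_step n U) (query_steps C) (0\<^sub>v (2 ^ n) + 1 \<cdot>\<^sub>v w) =
      x' + p' \<cdot>\<^sub>v fold (run_step n V) (query_steps C) w"
    by (rule fold_run_step_hybrid[OF U V steps \<open>0 \<le> \<delta>\<close> near]) (use w in auto)
  moreover have "vnorm (0\<^sub>v (2 ^ n)) = 0" by (simp add: vnorm_def L2_set_def)
  moreover have "0\<^sub>v (2 ^ n) + 1 \<cdot>\<^sub>v w = w" using w by auto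
  ultimately obtain x' p' where x': "cmod p' = 1" "x' \<in> carrier_vec (2 ^ n)"
    "vnorm x' \<le> \<delta> * num_queries C"
    "fold (run_step n U) (query_steps C) w = x' + p' \<cdot>\<^sub>v fold (run_step n V) (query_steps C) w"
    by (auto simp: num_queries_def)
  have "Re (system_state n (fold (run_step n U) (query_steps C) w) $$ (0, 0)) -
      Re (system_state n (fold (run_step n V) (query_steps C) w) $$ (0, 0)) \<le> 2 * vnorm x'"
    using fold_run_step_isometry[OF U w(1) steps] fold_run_step_isometry[OF V w(1) steps] w(2) n x'
    by (intro system_state_00_diff_le) auto
  then show ?thesis
    using x'(3) unfolding circuit_output_def final_state_def n_def w_def by simp
qed

text \<open>Makes the difference between an output and a target state Hermitian and traceless, as
  \<open>trace_norm_traceless_ge\<close> requires.\<close>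

lemma circuit_output_hermitian_trace:
  assumes wf: "wf_circuit C" and U: "unitary_mat 2 U"
  shows "circuit_output C U \<in> carrier_mat 2 2" "mat_adjoint (circuit_output C U) = circuit_output C U"
    "mat_trace (circuit_output C U) = 1"
proof -
  define n where "n = n_qubits C"
  define w where "w = first_gate C *\<^sub>v init_state C"
  have n: "n \<ge> 1" and steps: "wf_steps n (query_steps C)"
    and init: "init_state C \<in> carrier_vec (2 ^ n)" "init_state C \<bullet>c init_state C = 1"
    and fg: "unitary_mat (2 ^ n) (first_gate C)"
    using wf by (auto simp: wf_circuit_def n_def)
  have 1: "(vnorm (init_state C))\<^sup>2 = 1"
    using init(2) vnorm_cscalar[of "init_state C"] by (simp only: of_real_eq_1_iff)
  have w: "w \<in> carrier_vec (2 ^ n)" "vnorm w = vnorm (init_state C)"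
    using vnorm_unitary[OF fg init(1)] fg init
    by (auto simp: w_def unitary_mat_def intro!: mult_mat_vec_carrier)
  show "mat_trace (circuit_output C U) = 1"
    using fold_run_step_isometry[OF U w(1) steps] w(2) 1 system_state_trace[OF n]
    by (simp add: circuit_output_def final_state_def n_def w_def del: of_real_power)
qed (simp_all add: circuit_output_def system_state_adjoint)

section \<open>The exact solution\<close>

lemma cnj_mult_self: "cmod u = 1 \<Longrightarrow> cnj u * u = 1" "cmod u = 1 \<Longrightarrow> u * cnj u = 1"
  by (metis complex_norm_square mult.commute of_real_1 one_power2)+

text \<open>A solution is \<open>exp (- 3 \<i> g t / 4)\<close> times this vector at \<open>a = a0 - g t / 2\<close>.\<close>

definition gp_vec :: "real \<Rightarrow> real \<Rightarrow> complex vec" where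
  "gp_vec \<sigma> a = v2 ((1 + \<i> * tanh a + \<sigma> / cosh a) / 2) ((1 + \<i> * tanh a - \<sigma> / cosh a) / 2)"

lemma gp_vec_carrier [simp]: "gp_vec \<sigma> a \<in> carrier_vec 2"
  by (simp add: gp_vec_def)

lemma tanh_sech_squared: "(tanh a)\<^sup>2 + (1 / cosh a)\<^sup>2 = (1 :: real)"
proof -
  have "(sinh a)\<^sup>2 + 1 = (cosh a)\<^sup>2" by (simp add: cosh_square_eq)
  then show ?thesis
    by (simp add: tanh_def power_divide flip: add_divide_distrib)
qed

lemma ketbra_phase:
  assumes "v \<in> carrier_vec 2" "cmod c = 1"
  shows "ketbra (c \<cdot>\<^sub>v v) = ketbra v"
proof -
  note c = cnj_mult_self(2)[OF assms(2)]
  have "c * x * (cnj c * y) = x * y" for x y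
    by (metis (no_types, lifting) c mult.assoc mult.commute mult.left_neutral)
  with assms(1) c show ?thesis by (elim vec_two_cases) simp
qed

text \<open>The phase is a quotient of corresponding nonzero amplitudes; the off-diagonal entries
  show that the same quotient fits the other component.\<close>

lemma ketbra_eq_imp_phase:
  assumes "v \<in> carrier_vec 2" "w \<in> carrier_vec 2" "ketbra v = ketbra w" "w \<noteq> 0\<^sub>v 2"
  obtains c where "cmod c = 1" "v = c \<cdot>\<^sub>v w"
proof -
  obtain a b a' b' where v: "v = v2 a b" and w: "w = v2 a' b'"
    using assms(1,2) by (metis vec_two_cases)
  have eq: "a * cnj a = a' * cnj a'" "a * cnj b = a' * cnj b'" "b * cnj a = b' * cnj a'"
    "b * cnj b = b' * cnj b'"
    using assms(3) by (simp_all add: v w)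
  have na: "cmod a = cmod a'" and nb: "cmod b = cmod b'"
    using eq(1,4) by (metis complex_mod_sqrt_Re_mult_cnj)+
  show thesis
  proof (cases "a' = 0")
    case True
    then have "a = 0" using na by simp
    have "b' \<noteq> 0" using assms(4) True by (auto simp: w vec_two_eq_iff)
    then show thesis using that[of "b / b'"] True \<open>a = 0\<close> nb
      by (simp add: v w norm_divide)
  next
    case False
    then have "a \<noteq> 0" using na by auto
    have "b * (cnj a * a) = a / a' * b' * (cnj a' * a')"
      using eq(3) False by (simp add: field_simps)
    moreover have "cnj a * a = cnj a' * a'" using eq(1) by (simp add: mult.commute)
    ultimately have "b = a / a' * b'" using False \<open>a \<noteq> 0\<close>
      by (metis complex_cnj_zero_iff mult_cancel_right mult_eq_0_iff)
    then show thesis using that[of "a / a'"] False na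
      by (simp add: v w norm_divide)
  qed
qed

text \<open>The sum of \<open>\<rho>\<close> and its conjugate by \<open>Z\<close> is twice the
  diagonal part of \<open>\<rho>\<close>, so the nonlinear term only sees the populations.\<close>

lemma gp_hamiltonian_mult:
  "gp_hamiltonian g (ketbra (v2 a b)) *\<^sub>v v2 a b =
     v2 (g / 4 * b + g * (a * cnj a) * a) (g / 4 * a + g * (b * cnj b) * b)"
  by (simp add: gp_hamiltonian_def pauli_X_m2 pauli_Z_m2 field_simps)

text \<open>Direct differentiation. The two components differ only in a sign \<open>k\<close>, which
  is \<open>\<sigma>\<close> or \<open>- \<sigma>\<close>, so the computation \<open>gen\<close> for
  \<open>k\<close> with square 1 covers both equations.\<close>

lemma gp_solution_gp_vec:
  assumes \<sigma>: "\<sigma> \<in> {1, -1}" and c: "cmod c = 1"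
  shows "gp_solution g (\<lambda>t. (c * exp (- (3 * \<i> * g / 4) * of_real t)) \<cdot>\<^sub>v gp_vec \<sigma> (a0 - g * t / 2))"
    (is "gp_solution g ?\<psi>")
  unfolding gp_solution_def
proof (intro allI impI conjI)
  fix t :: real assume "0 \<le> t"
  show "?\<psi> t \<in> carrier_vec 2" by simp
  define e where "e = (\<lambda>t::real. c * exp (- (3 * \<i> * g / 4) * of_real t))"
  define \<tau> where "\<tau> = tanh (a0 - g * t / 2)"
  define s where "s = 1 / cosh (a0 - g * t / 2)"
  have ts: "\<tau>\<^sup>2 + s\<^sup>2 = 1" unfolding \<tau>_def s_def by (rule tanh_sech_squared)
  have \<sigma>2: "\<sigma>\<^sup>2 = 1" and \<sigma>2': "(- \<sigma>)\<^sup>2 = 1" using \<sigma> by auto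
  have de: "(e has_vector_derivative - (3 * \<i> * g / 4) * e t) (at t within {0..})"
  proof -
    have "((\<lambda>z. c * exp (- (3 * \<i> * g / 4) * z)) has_field_derivative - (3 * \<i> * g / 4) * e t)
        (at (of_real t))"
      by (auto simp: e_def intro!: derivative_eq_intros)
    then show ?thesis
      unfolding e_def by (rule has_vector_derivative_real_field)
  qed
  have dt: "((\<lambda>t. tanh (a0 - g * t / 2)) has_real_derivative - (g / 2) * s\<^sup>2) (at t within {0..})"
  proof -
    have s2: "s\<^sup>2 = 1 - \<tau>\<^sup>2" using ts by linarith
    show ?thesis unfolding s2 unfolding \<tau>_def by (auto intro!: derivative_eq_intros)
  qed
  have ds: "((\<lambda>t. 1 / cosh (a0 - g * t / 2)) has_real_derivative (g / 2) * \<tau> * s) (at t within {0..})"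
    by (auto intro!: derivative_eq_intros simp: s_def \<tau>_def tanh_def field_simps power2_eq_square)
  have gen: "((\<lambda>t. e t * ((1 + \<i> * of_real (tanh (a0 - g * t / 2)) + of_real k * of_real (1 / cosh
      (a0 - g * t / 2))) / 2))
      has_vector_derivative - \<i> * (g / 4 * (e t * ((1 + \<i> * \<tau> - k * s) / 2)) +
        g * ((1 + k * s) / 2) * (e t * ((1 + \<i> * \<tau> + k * s) / 2)))) (at t within {0..})"
    if "k\<^sup>2 = 1" for k :: real
  proof -
    have k2: "k * (k * x) = x" for x using that
      by (metis mult.assoc mult_1 power2_eq_square)
    have t2: "\<tau>\<^sup>2 = 1 - s\<^sup>2" using ts by linarith
    have D: "((\<lambda>t. e t * ((1 + \<i> * of_real (tanh (a0 - g * t / 2)) + of_real k * of_real (1 / cosh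
        (a0 - g * t / 2))) / 2))
      has_vector_derivative e t * ((0 + \<i> * of_real (- (g / 2) * s\<^sup>2) + of_real k * of_real ((g / 2)
          * \<tau> * s)) / 2)
        + - (3 * \<i> * g / 4) * e t * ((1 + \<i> * \<tau> + of_real k * of_real s) / 2)) (at t within {0..})"
      unfolding \<tau>_def s_def
      by (intro has_vector_derivative_mult has_vector_derivative_divide has_vector_derivative_add
          has_vector_derivative_mult_right has_vector_derivative_of_real has_vector_derivative_const
          dt[unfolded \<tau>_def s_def] ds[unfolded \<tau>_def s_def] de)
    have factor: "x * w + m * x * y = n * (h * (x * z) + l * (x * y))"
      if "w + m * y = n * (h * z + l * y)" for x y z w m n h l :: complex
    proof -
      have "x * w + m * x * y = x * (w + m * y)" by (simp add: algebra_simps)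
      then show ?thesis unfolding that by (simp add: algebra_simps)
    qed
    have "((0 + \<i> * of_real (- (g / 2) * s\<^sup>2) + of_real k * of_real ((g / 2) * \<tau> * s)) / 2)
        + - (3 * \<i> * g / 4) * ((1 + \<i> * \<tau> + k * s) / 2) =
       - \<i> * (g / 4 * ((1 + \<i> * \<tau> - k * s) / 2) +
        g * ((1 + k * s) / 2) * ((1 + \<i> * \<tau> + k * s) / 2))"
      by (simp add: complex_eq_iff field_simps power2_eq_square k2)
    then show ?thesis
      by (intro has_vector_derivative_eq_rhs[OF D[folded of_real_mult[of k s]]] factor)
  qed
  have ee: "e t * cnj (e t) = 1"
  proof -
    have "cmod (e t) = 1" using c by (simp add: e_def norm_mult)
    then show ?thesis by (metis complex_norm_square of_real_1 one_power2)
  qed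
  \<comment> \<open>These are the populations that \<open>gen\<close> has already substituted into
    the nonlinear term.\<close>
  have nrm: "(e t * ((1 + \<i> * \<tau> + k * s) / 2)) * cnj (e t * ((1 + \<i> * \<tau> + k * s) / 2)) = (1 + k * s) / 2"
    if "k\<^sup>2 = 1" for k :: real
  proof -
    have "(1 + \<i> * \<tau> + k * s) * cnj (1 + \<i> * \<tau> + k * s) = of_real ((1 + k * s)\<^sup>2 + \<tau>\<^sup>2)"
      by (simp add: complex_eq_iff power2_eq_square algebra_simps)
    also have "(1 + k * s)\<^sup>2 + \<tau>\<^sup>2 = 2 * (1 + k * s)"
      using ts that by (simp add: power2_sum power_mult_distrib)
    finally have "(1 + \<i> * \<tau> + k * s) * cnj (1 + \<i> * \<tau> + k * s) = of_real (2 * (1 + k * s))" .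
    moreover have "(e t * ((1 + \<i> * \<tau> + k * s) / 2)) * cnj (e t * ((1 + \<i> * \<tau> + k * s) / 2))
      = (e t * cnj (e t)) * ((1 + \<i> * \<tau> + k * s) * cnj (1 + \<i> * \<tau> + k * s)) / 4"
      by simp
    ultimately show ?thesis by (simp add: ee)
  qed
  have \<psi>: "?\<psi> u = v2 (e u * ((1 + \<i> * of_real (tanh (a0 - g * u / 2)) + of_real \<sigma> * of_real (1 /
      cosh (a0 - g * u / 2))) / 2))
     (e u * ((1 + \<i> * of_real (tanh (a0 - g * u / 2)) + of_real (- \<sigma>) * of_real (1 / cosh (a0 - g *
         u / 2))) / 2))" for u
    by (simp add: gp_vec_def e_def)
  have \<psi>t: "?\<psi> t = v2 (e t * ((1 + \<i> * \<tau> + \<sigma> * s) / 2)) (e t * ((1 + \<i> * \<tau> + (- \<sigma>) * s) / 2))"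
    unfolding \<psi> by (simp add: \<tau>_def s_def)
  fix i :: nat assume "i < 2"
  then consider "i = 0" | "i = 1" by (auto simp: less_two_iff)
  then show "((\<lambda>s. ?\<psi> s $ i) has_vector_derivative
        - \<i> * (gp_hamiltonian g (ketbra (?\<psi> t)) *\<^sub>v ?\<psi> t) $ i) (at t within {0..})"
  proof cases
    case 1
    show ?thesis
      unfolding \<psi>t gp_hamiltonian_mult unfolding \<psi> 1 v2_index nrm[OF \<sigma>2]
      using gen[OF \<sigma>2] by simp
  next
    case 2
    show ?thesis
      unfolding \<psi>t gp_hamiltonian_mult unfolding \<psi> 2 v2_index One_nat_def nrm[OF \<sigma>2']
      using gen[OF \<sigma>2'] by simp
  qed
qed

section \<open>Uniqueness of the density operator\<close>

text \<open>Derivatives are taken within \<open>{0..}\<close>, so at 0 only from the right. At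
  interior points they are ordinary derivatives, and at 0 continuity is enough.\<close>

lemma nonincreasing_Ici:
  fixes f :: "real \<Rightarrow> real"
  assumes f: "\<And>t. t \<ge> 0 \<Longrightarrow> (f has_real_derivative f' t) (at t within {0..})"
    and "\<And>t. t \<ge> 0 \<Longrightarrow> f' t \<le> 0" and "0 \<le> t"
  shows "f t \<le> f 0"
proof (rule DERIV_nonpos_imp_decreasing_open[OF \<open>0 \<le> t\<close>])
  fix x :: real assume "0 < x"
  then have "at x within {0..} = at x"
    by (intro at_within_nhd[where S = "{0<..}"]) auto
  then show "\<exists>y. (f has_real_derivative y) (at x) \<and> y \<le> 0"
    using f[of x] assms(2)[of x] \<open>0 < x\<close> by auto
next
  have "continuous_on {0..} f"
    using f by (intro DERIV_continuous_on) auto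
  then show "continuous_on {0..t} f"
    by (rule continuous_on_subset) auto
qed

lemma constant_Ici:
  fixes f :: "real \<Rightarrow> real"
  assumes "\<And>t. t \<ge> 0 \<Longrightarrow> (f has_real_derivative 0) (at t within {0..})" and "0 \<le> t"
  shows "f t = f 0"
  using nonincreasing_Ici[of f "\<lambda>_. 0" t] nonincreasing_Ici[of "\<lambda>t. - f t" "\<lambda>_. 0" t] assms
    DERIV_minus[of f 0]
  by fastforce

lemma ketbra_bloch:
  assumes "v \<in> carrier_vec 2"
    "(cmod (v $ 0))\<^sup>2 + (cmod (v $ Suc 0))\<^sup>2 = 1"
    "2 * Re (cnj (v $ 0) * v $ Suc 0) = x" "2 * Im (cnj (v $ 0) * v $ Suc 0) = y"
    "(cmod (v $ 0))\<^sup>2 - (cmod (v $ Suc 0))\<^sup>2 = z"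
  shows "ketbra v = bloch_state (x, y, z)"
proof -
  obtain a b where v: "v = v2 a b" using assms(1) by (rule vec_two_cases)
  have "(cmod a)\<^sup>2 = (1 + z) / 2" "(cmod b)\<^sup>2 = (1 - z) / 2"
    using assms(2,5) by (simp_all add: v)
  then have "a * cnj a = of_real ((1 + z) / 2)" "b * cnj b = of_real ((1 - z) / 2)"
    by (metis complex_norm_square)+
  moreover have "b * cnj a = (x + \<i> * y) / 2" "a * cnj b = (x - \<i> * y) / 2"
    using assms(3,4) by (auto simp: v complex_eq_iff)
  ultimately show ?thesis
    by (simp add: v bloch_state_m2)
qed

lemma gp_amplitude_norm:
  fixes a k :: real
  assumes "k\<^sup>2 = 1"
  shows "(cmod ((1 + \<i> * tanh a + of_real (k / cosh a)) / 2))\<^sup>2 = (1 + k / cosh a) / 2"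
proof -
  have "(cmod ((1 + \<i> * tanh a + of_real (k / cosh a)) / 2))\<^sup>2 = ((1 + k / cosh a)\<^sup>2 + (tanh a)\<^sup>2) / 4"
    by (simp add: norm_divide power_divide cmod_power2)
  also have "(tanh a)\<^sup>2 = 1 - (k / cosh a)\<^sup>2"
    using tanh_sech_squared[of a] assms by (simp add: power_divide)
  also have "((1 + k / cosh a)\<^sup>2 + (1 - (k / cosh a)\<^sup>2)) / 4 = (1 + k / cosh a) / 2"
    by (simp add: power2_sum)
  finally show ?thesis .
qed

lemma ketbra_gp_vec:
  assumes \<sigma>: "\<sigma> \<in> {1, -1}"
  shows "ketbra (gp_vec \<sigma> a) = bloch_state ((tanh a)\<^sup>2, \<sigma> * tanh a / cosh a, \<sigma> / cosh a)"
proof (rule ketbra_bloch)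
  have \<sigma>2: "\<sigma>\<^sup>2 = 1" "(- \<sigma>)\<^sup>2 = 1" using \<sigma> by auto
  have v: "gp_vec \<sigma> a = v2 ((1 + \<i> * tanh a + of_real (\<sigma> / cosh a)) / 2)
      ((1 + \<i> * tanh a + of_real (- \<sigma> / cosh a)) / 2)"
    by (simp add: gp_vec_def)
  show "(cmod (gp_vec \<sigma> a $ 0))\<^sup>2 + (cmod (gp_vec \<sigma> a $ Suc 0))\<^sup>2 = 1"
    and "(cmod (gp_vec \<sigma> a $ 0))\<^sup>2 - (cmod (gp_vec \<sigma> a $ Suc 0))\<^sup>2 = \<sigma> / cosh a"
    unfolding v v2_index gp_amplitude_norm[OF \<sigma>2(1)] gp_amplitude_norm[OF \<sigma>2(2)]
    by (simp_all add: field_simps)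
  show "2 * Im (cnj (gp_vec \<sigma> a $ 0) * gp_vec \<sigma> a $ Suc 0) = \<sigma> * tanh a / cosh a"
    unfolding v v2_index by (simp add: field_simps)
  have "(\<sigma> / cosh a)\<^sup>2 = 1 - (tanh a)\<^sup>2"
    using tanh_sech_squared[of a] \<sigma>2 by (simp add: power_divide)
  moreover have "2 * Re (cnj (gp_vec \<sigma> a $ 0) * gp_vec \<sigma> a $ Suc 0) =
      (1 - (\<sigma> / cosh a)\<^sup>2 + (tanh a)\<^sup>2) / 2"
    unfolding v v2_index by (simp add: algebra_simps power2_eq_square add_divide_distrib
        diff_divide_distrib)
  ultimately show "2 * Re (cnj (gp_vec \<sigma> a $ 0) * gp_vec \<sigma> a $ Suc 0) = (tanh a)\<^sup>2" by simp
qed simp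

text \<open>Along a solution the norm and \<open>x + z\<^sup>2\<close> are conserved, so that \<open>(z, y)\<close> solves an
  autonomous planar system, for which uniqueness follows from a Gronwall estimate.\<close>

lemma bloch_ode_unique:
  fixes z y Z Y :: "real \<Rightarrow> real"
  assumes g: "g > 0"
    and dz: "\<And>t. t \<ge> 0 \<Longrightarrow> (z has_real_derivative g / 2 * y t) (at t within {0..})"
    and dy: "\<And>t. t \<ge> 0 \<Longrightarrow> (y has_real_derivative g / 2 * z t - g * z t ^ 3) (at t within {0..})"
    and dZ: "\<And>t. t \<ge> 0 \<Longrightarrow> (Z has_real_derivative g / 2 * Y t) (at t within {0..})"
    and dY: "\<And>t. t \<ge> 0 \<Longrightarrow> (Y has_real_derivative g / 2 * Z t - g * Z t ^ 3) (at t within {0..})"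
    and bound: "\<And>t. t \<ge> 0 \<Longrightarrow> \<bar>z t\<bar> \<le> 1" "\<And>t. t \<ge> 0 \<Longrightarrow> \<bar>Z t\<bar> \<le> 1"
    and init: "z 0 = Z 0" "y 0 = Y 0" and t: "t \<ge> 0"
  shows "z t = Z t \<and> y t = Y t"
proof -
  define E where "E = (\<lambda>t. (z t - Z t)\<^sup>2 + (y t - Y t)\<^sup>2)"
  \<comment> \<open>The cofactor of \<open>z - Z\<close> in the difference of the cubes of
    \<open>z\<close> and \<open>Z\<close>.\<close>
  define q where "q = (\<lambda>t. (z t)\<^sup>2 + z t * Z t + (Z t)\<^sup>2)"
  define E' where "E' = (\<lambda>t. 2 * g * (z t - Z t) * (y t - Y t) * (1 - q t))"
  have dE: "(E has_real_derivative E' t) (at t within {0..})" if "t \<ge> 0" for t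
  proof -
    have "(E has_real_derivative 2 * (z t - Z t) * (g / 2 * y t - g / 2 * Y t) +
        2 * (y t - Y t) * ((g / 2 * z t - g * z t ^ 3) - (g / 2 * Z t - g * Z t ^ 3))) (at t within
            {0..})"
      unfolding E_def
      by (rule derivative_eq_intros dz[OF that] dy[OF that] dZ[OF that] dY[OF that] refl)+
        (simp add: algebra_simps add_divide_distrib diff_divide_distrib)
    also have "2 * (z t - Z t) * (g / 2 * y t - g / 2 * Y t) +
        2 * (y t - Y t) * ((g / 2 * z t - g * z t ^ 3) - (g / 2 * Z t - g * Z t ^ 3)) = E' t"
    proof -
      \<comment> \<open>Writing \<open>g\<close> as \<open>2 * h\<close> removes the halves before
        ring normalisation.\<close>
      obtain h where h: "g = 2 * h" by (metis field_sum_of_halves mult_2)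
      show ?thesis
        unfolding E'_def q_def h by (simp add: algebra_simps power2_eq_square power3_eq_cube)
    qed
    finally show ?thesis .
  qed
  have le: "E' t \<le> 4 * g * E t" if "t \<ge> 0" for t
  proof -
    have b: "\<bar>z t\<bar> \<le> 1" "\<bar>Z t\<bar> \<le> 1" using bound that by auto
    then have "(z t)\<^sup>2 \<le> 1" "(Z t)\<^sup>2 \<le> 1" "\<bar>z t * Z t\<bar> \<le> 1"
      by (auto simp: abs_square_le_1 abs_mult mult_le_one)
    then have "\<bar>1 - q t\<bar> \<le> 4"
      unfolding q_def by (smt (verit) zero_le_power2)
    have "2 * \<bar>(z t - Z t) * (y t - Y t)\<bar> \<le> E t"
      using sum_squares_bound[of "\<bar>z t - Z t\<bar>" "\<bar>y t - Y t\<bar>"]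
      by (simp add: E_def abs_mult mult.assoc)
    have "E' t = g * (2 * (((z t - Z t) * (y t - Y t)) * (1 - q t)))"
      by (simp add: E'_def mult.assoc)
    also have "\<dots> \<le> g * (2 * \<bar>((z t - Z t) * (y t - Y t)) * (1 - q t)\<bar>)"
      using g by (intro mult_left_mono abs_ge_self) auto
    also have "\<dots> = g * (2 * \<bar>(z t - Z t) * (y t - Y t)\<bar> * \<bar>1 - q t\<bar>)"
      by (simp add: abs_mult)
    also have "\<dots> \<le> g * (E t * 4)"
      using \<open>\<bar>1 - q t\<bar> \<le> 4\<close> \<open>2 * \<bar>(z t - Z t) * (y t - Y t)\<bar> \<le> E t\<close> g
      by (intro mult_left_mono mult_mono) (auto simp: E_def)
    finally show ?thesis by simp
  qed
  \<comment> \<open>Gronwall's argument: the exponential weight turns the bound \<open>le\<close> on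
    the derivative into monotonicity, and \<open>E\<close> starts at 0.\<close>
  have "exp (- 4 * g * t) * E t \<le> exp (- 4 * g * 0) * E 0"
  proof (rule nonincreasing_Ici[where f = "\<lambda>t. exp (- 4 * g * t) * E t"
      and f' = "\<lambda>t. exp (- 4 * g * t) * (E' t - 4 * g * E t)"])
    fix t :: real assume t: "t \<ge> 0"
    show "((\<lambda>t. exp (- 4 * g * t) * E t) has_real_derivative
        exp (- 4 * g * t) * (E' t - 4 * g * E t)) (at t within {0..})"
      by (rule derivative_eq_intros dE[OF t] refl)+ (simp add: algebra_simps)
    show "exp (- 4 * g * t) * (E' t - 4 * g * E t) \<le> 0"
      using le[OF t] by (simp add: mult_le_0_iff)
  qed (rule t)
  also have "\<dots> = 0" using init by (simp add: E_def)
  finally have "E t \<le> 0" by (simp add: mult_le_0_iff)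
  then show ?thesis unfolding E_def by (simp add: sum_power2_le_zero_iff)
qed

text \<open>Bloch coordinates forget the global phase, so they suffice for the projector. After
  \<open>x\<close> is eliminated by a conserved quantity, the explicit functions \<open>Z\<close>
  and \<open>Y\<close> solve the same planar system as \<open>z\<close> and \<open>y\<close> with
  the same initial values.\<close>

lemma gp_solution_ketbra:
  assumes g: "g > 0" and \<sigma>: "\<sigma> \<in> {1, -1}" and sol: "gp_solution g \<psi>"
    and init: "ketbra (\<psi> 0) = ketbra (gp_vec \<sigma> a0)" and T: "T \<ge> 0"
  shows "ketbra (\<psi> T) = ketbra (gp_vec \<sigma> (a0 - g * T / 2))"
proof -
  define p where "p = (\<lambda>t. Re (\<psi> t $ 0))"
  define q where "q = (\<lambda>t. Im (\<psi> t $ 0))"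
  define r where "r = (\<lambda>t. Re (\<psi> t $ Suc 0))"
  define s where "s = (\<lambda>t. Im (\<psi> t $ Suc 0))"
  have carr: "\<psi> t \<in> carrier_vec 2" if "t \<ge> 0" for t using sol that by (simp add: gp_solution_def)
  have \<psi>: "\<psi> t = v2 (Complex (p t) (q t)) (Complex (r t) (s t))" if "t \<ge> 0" for t
    using carr[OF that] by (simp add: vec_two_eq_iff p_def q_def r_def s_def)
  have D: "(p has_real_derivative g / 4 * s t + g * ((p t)\<^sup>2 + (q t)\<^sup>2) * q t) (at t within {0..})
     \<and> (q has_real_derivative - (g / 4 * r t + g * ((p t)\<^sup>2 + (q t)\<^sup>2) * p t)) (at t within {0..})
     \<and> (r has_real_derivative g / 4 * q t + g * ((r t)\<^sup>2 + (s t)\<^sup>2) * s t) (at t within {0..})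
     \<and> (s has_real_derivative - (g / 4 * p t + g * ((r t)\<^sup>2 + (s t)\<^sup>2) * r t)) (at t within {0..})"
    if t: "t \<ge> 0" for t
  proof -
    have "((\<lambda>s. \<psi> s $ i) has_vector_derivative
        - \<i> * (gp_hamiltonian g (ketbra (\<psi> t)) *\<^sub>v \<psi> t) $ i) (at t within {0..})" if "i < 2" for i
      using sol t that by (simp add: gp_solution_def)
    from this[of 0] this[of 1] show ?thesis
      unfolding \<psi>[OF t] gp_hamiltonian_mult
      unfolding has_vector_derivative_complex_iff p_def[symmetric] q_def[symmetric]
        r_def[symmetric] s_def[symmetric] One_nat_def
      by (simp add: power2_eq_square algebra_simps flip: has_real_derivative_iff_has_vector_derivative
          p_def q_def r_def s_def)
  qed
  define N where "N = (\<lambda>t. (p t)\<^sup>2 + (q t)\<^sup>2 + (r t)\<^sup>2 + (s t)\<^sup>2)"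
  define x where "x = (\<lambda>t. 2 * (p t * r t + q t * s t))"
  define y where "y = (\<lambda>t. 2 * (p t * s t - q t * r t))"
  define z where "z = (\<lambda>t. (p t)\<^sup>2 + (q t)\<^sup>2 - (r t)\<^sup>2 - (s t)\<^sup>2)"
  have dN: "(N has_real_derivative 0) (at t within {0..})"
    and dx: "(x has_real_derivative - g * z t * y t) (at t within {0..})"
    and dy: "(y has_real_derivative g * z t * x t - g / 2 * z t) (at t within {0..})"
    and dz: "(z has_real_derivative g / 2 * y t) (at t within {0..})" if "t \<ge> 0" for t
    unfolding N_def x_def y_def z_def
    using D[OF that]
    by (auto intro!: derivative_eq_intros simp: algebra_simps power2_eq_square)
  have "ketbra (\<psi> 0) = bloch_state ((tanh a0)\<^sup>2, \<sigma> * tanh a0 / cosh a0, \<sigma> / cosh a0)"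
    using init ketbra_gp_vec[OF \<sigma>] by simp
  then have 0: "(p 0)\<^sup>2 + (q 0)\<^sup>2 = (1 + \<sigma> / cosh a0) / 2" "(r 0)\<^sup>2 + (s 0)\<^sup>2 = (1 - \<sigma> / cosh a0) / 2"
    "r 0 * p 0 + s 0 * q 0 = (tanh a0)\<^sup>2 / 2" "s 0 * p 0 - r 0 * q 0 = (\<sigma> * tanh a0 / cosh a0) / 2"
    unfolding \<psi>[OF order_refl] bloch_state_m2
    by (auto simp: complex_eq_iff power2_eq_square)
  have N: "N t = 1" if "t \<ge> 0" for t
  proof -
    have "N t = N 0" by (rule constant_Ici[OF dN that])
    also have "\<dots> = 1" using 0 by (simp add: N_def)
    finally show ?thesis .
  qed
  \<comment> \<open>At time 0 the conserved quantity is the sum of the squares of tanh and 1 / cosh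
    at \<open>a0\<close>, which is 1.\<close>
  have x: "x t = 1 - (z t)\<^sup>2" if "t \<ge> 0" for t
  proof -
    have "x t + (z t)\<^sup>2 = x 0 + (z 0)\<^sup>2"
      by (rule constant_Ici[OF _ that, where f = "\<lambda>t. x t + (z t)\<^sup>2"])
        (auto intro!: derivative_eq_intros dx dz)
    also have "x 0 = (tanh a0)\<^sup>2" using 0 by (simp add: x_def mult.commute)
    also have "z 0 = \<sigma> / cosh a0"
      unfolding z_def using 0(1,2) by (simp add: field_simps)
    also have "(\<sigma> / cosh a0)\<^sup>2 = (1 / cosh a0)\<^sup>2"
      using \<sigma> by (auto simp: power_divide)
    finally show ?thesis using tanh_sech_squared[of a0] by simp
  qed
  define Z where "Z = (\<lambda>t. \<sigma> / cosh (a0 - g * t / 2))"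
  define Y where "Y = (\<lambda>t. \<sigma> * tanh (a0 - g * t / 2) / cosh (a0 - g * t / 2))"
  have \<sigma>3: "\<sigma> ^ 3 = \<sigma>" using \<sigma> by auto
  have "z T = Z T \<and> y T = Y T"
  proof (rule bloch_ode_unique[OF g _ _ _ _ _ _ _ _ T])
    fix t :: real assume t: "t \<ge> 0"
    show "(z has_real_derivative g / 2 * y t) (at t within {0..})" by (rule dz[OF t])
    show "(y has_real_derivative g / 2 * z t - g * z t ^ 3) (at t within {0..})"
      using dy[OF t] unfolding x[OF t]
      by (simp add: algebra_simps power2_eq_square power3_eq_cube)
    show "(Z has_real_derivative g / 2 * Y t) (at t within {0..})"
      unfolding Z_def Y_def
      by (auto intro!: derivative_eq_intros simp: tanh_def field_simps power2_eq_square)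
    define u where "u = a0 - g * t / 2"
    have "(Y has_real_derivative g / 2 * (\<sigma> * ((tanh u)\<^sup>2 - (1 - (tanh u)\<^sup>2)) / cosh u)) (at t
        within {0..})"
      unfolding Y_def u_def
      by (auto intro!: derivative_eq_intros simp: tanh_def field_simps power2_eq_square)
    also have "(tanh u)\<^sup>2 = 1 - (1 / cosh u)\<^sup>2" using tanh_sech_squared[of u] by linarith
    also have "g / 2 * (\<sigma> * (1 - (1 / cosh u)\<^sup>2 - (1 - (1 - (1 / cosh u)\<^sup>2))) / cosh u) =
        g / 2 * Z t - g * Z t ^ 3"
      unfolding Z_def u_def[symmetric] power_divide \<sigma>3
      by (simp add: power2_eq_square power3_eq_cube field_simps)
    finally show "(Y has_real_derivative g / 2 * Z t - g * Z t ^ 3) (at t within {0..})" .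
    have "N t = 1" by (rule N[OF t])
    then show "\<bar>z t\<bar> \<le> 1" unfolding N_def z_def by (smt (verit) zero_le_power2)
    show "\<bar>Z t\<bar> \<le> 1" using \<sigma> cosh_real_ge_1[of "a0 - g * t / 2"] by (auto simp: Z_def)
  next
    show "z 0 = Z 0" "y 0 = Y 0"
      using 0 by (auto simp: z_def Z_def y_def Y_def field_simps)
  qed
  then have zT: "z T = \<sigma> / cosh (a0 - g * T / 2)"
    and yT: "y T = \<sigma> * tanh (a0 - g * T / 2) / cosh (a0 - g * T / 2)" by (simp_all add: Z_def Y_def)
  have xT: "x T = (tanh (a0 - g * T / 2))\<^sup>2"
    using x[OF T] zT tanh_sech_squared[of "a0 - g * T / 2"] \<sigma> by (auto simp: power_divide)
  have "ketbra (\<psi> T) = bloch_state (x T, y T, z T)"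
    using N[OF T] \<psi>[OF T]
    by (intro ketbra_bloch[OF carr[OF T]]) (auto simp: cmod_power2 N_def x_def y_def z_def algebra_simps)
  then show ?thesis unfolding ketbra_gp_vec[OF \<sigma>] xT yT zT .
qed

text \<open>The explicit solution gives existence for the definite description, and
  \<open>gp_solution_ketbra\<close> shows that every solution has this projector.\<close>

lemma gp_state_gp_vec:
  assumes "g > 0" "\<sigma> \<in> {1, -1}" "cmod c = 1" "T \<ge> 0"
  shows "gp_state g (c \<cdot>\<^sub>v gp_vec \<sigma> a0) T = ketbra (gp_vec \<sigma> (a0 - g * T / 2))"
  unfolding gp_state_def
proof (rule the_equality)
  let ?\<psi> = "\<lambda>t. (c * exp (- (3 * \<i> * g / 4) * of_real t)) \<cdot>\<^sub>v gp_vec \<sigma> (a0 - g * t / 2)"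
  have sol: "gp_solution g ?\<psi>" by (rule gp_solution_gp_vec) (use assms in auto)
  have "ketbra (?\<psi> 0) = ketbra (gp_vec \<sigma> a0)" using assms by (simp add: ketbra_phase)
  then have "ketbra (?\<psi> T) = ketbra (gp_vec \<sigma> (a0 - g * T / 2))"
    using assms sol by (intro gp_solution_ketbra) auto
  then show "\<exists>\<psi>. gp_solution g \<psi> \<and> \<psi> 0 = c \<cdot>\<^sub>v gp_vec \<sigma> a0 \<and>
      ketbra (gp_vec \<sigma> (a0 - g * T / 2)) = ketbra (\<psi> T)"
    using sol by (intro exI[of _ ?\<psi>]) simp
next
  fix \<rho> assume "\<exists>\<psi>. gp_solution g \<psi> \<and> \<psi> 0 = c \<cdot>\<^sub>v gp_vec \<sigma> a0 \<and> \<rho> = ketbra (\<psi> T)"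
  then show "\<rho> = ketbra (gp_vec \<sigma> (a0 - g * T / 2))"
    using assms gp_solution_ketbra ketbra_phase[OF gp_vec_carrier] by metis
qed

text \<open>The sign of \<open>a0\<close> selects \<open>tanh a0 = sqrt (1 - \<xi>)\<close>, so the
  Bloch vectors agree and only a global phase remains.\<close>

lemma initial_state_eq_gp_vec:
  assumes \<sigma>: "\<sigma> \<in> {1, -1}" and \<xi>: "0 < \<xi>" "\<xi> < 1" and a0: "a0 \<ge> 0" "cosh a0 = 1 / sqrt \<xi>"
    and \<phi>: "\<phi> \<in> carrier_vec 2" "ketbra \<phi> = bloch_state (initial_bloch \<sigma> \<xi>)"
  obtains c where "cmod c = 1" "\<phi> = c \<cdot>\<^sub>v gp_vec \<sigma> a0"
proof -
  have t2: "(tanh a0)\<^sup>2 = 1 - \<xi>"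
    using tanh_sech_squared[of a0] a0(2) \<xi> by simp
  moreover have "tanh a0 \<ge> 0" using a0(1) by simp
  ultimately have "tanh a0 = sqrt (1 - \<xi>)" by (metis real_sqrt_abs abs_of_nonneg)
  then have "ketbra \<phi> = ketbra (gp_vec \<sigma> a0)"
    unfolding \<phi> ketbra_gp_vec[OF \<sigma>] initial_bloch_def
    using t2 a0 \<xi> by (simp add: real_sqrt_mult mult_ac)
  \<comment> \<open>The two components add up to a number with real part 1.\<close>
  moreover have "gp_vec \<sigma> a0 \<noteq> 0\<^sub>v 2"
  proof
    assume "gp_vec \<sigma> a0 = 0\<^sub>v 2"
    then have "gp_vec \<sigma> a0 $ 0 + gp_vec \<sigma> a0 $ Suc 0 = 0" by simp
    then show False by (simp add: gp_vec_def complex_eq_iff flip: add_divide_distrib)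
  qed
  ultimately show thesis
    using \<phi>(1) that ketbra_eq_imp_phase[of \<phi> "gp_vec \<sigma> a0"] by auto
qed

section \<open>Exact amplitude amplification\<close>

text \<open>\<open>xv p m\<close> has the components \<open>p / sqrt 2\<close> and \<open>m / sqrt 2\<close> in the eigenbasis of \<open>X\<close>, in which
  \<open>xm a b\<close> is diagonal.\<close>

definition xv :: "complex \<Rightarrow> complex \<Rightarrow> complex vec" where
  "xv p m = v2 ((p + m) / 2) ((p - m) / 2)"

definition xm :: "complex \<Rightarrow> complex \<Rightarrow> complex mat" where
  "xm a b = m2 ((a + b) / 2) ((a - b) / 2) ((a - b) / 2) ((a + b) / 2)"

lemma xv_carrier [simp]: "xv p m \<in> carrier_vec 2"
  by (simp add: xv_def)

lemma xm_carrier [simp]: "xm a b \<in> carrier_mat 2 2"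
  by (simp add: xm_def)

lemma xm_mult_smult_xv [simp]: "xm a b *\<^sub>v (k \<cdot>\<^sub>v xv p m) = k \<cdot>\<^sub>v xv (a * p) (b * m)"
  by (simp add: xm_def xv_def field_simps)

lemma xm_unitary:
  assumes "cmod a = 1" "cmod b = 1"
  shows "unitary_mat 2 (xm a b)"
  using cnj_mult_self[OF assms(1)] cnj_mult_self[OF assms(2)]
  by (simp add: unitary_mat_def xm_def one_mat_two field_simps)

lemma phase_gate_unitary: "cmod e = 1 \<Longrightarrow> unitary_mat 2 (m2 e 0 0 1)"
  using cnj_mult_self[of e] by (simp add: unitary_mat_def one_mat_two)

lemma gp_vec_xv: "gp_vec \<sigma> a = xv (1 + \<i> * tanh a) (\<sigma> * (1 / cosh a))"
  by (simp add: gp_vec_def xv_def)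

text \<open>The product of the three matrices is the identity plus \<open>e - 1\<close> times the
  projector on \<open>U |0>\<close>. In the \<open>X\<close> basis the sign \<open>\<sigma>\<close>
  sits in the second amplitude of both the state and the axis, so it cancels from their overlap
  \<open>l * t\<close>; the modulus of \<open>k\<close> supplies the normalisation missing in
  \<open>xv\<close>.\<close>

lemma reflection_xv:
  assumes U: "unitary_mat 2 U" "U *\<^sub>v unit_vec 2 0 = k \<cdot>\<^sub>v xv (\<omega> * of_real C) (of_real \<sigma> * of_real S)"
    and k: "(cmod k)\<^sup>2 = 2" and \<omega>: "cmod \<omega> = 1" and \<sigma>: "\<sigma> \<in> {1, -1}"
    and t: "t = C * x + S * y"
  shows "U *\<^sub>v (m2 e 0 0 1 *\<^sub>v (mat_adjoint U *\<^sub>v (l \<cdot>\<^sub>v (k \<cdot>\<^sub>v xv (\<omega> * x) (of_real \<sigma> * y))))) =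
     l \<cdot>\<^sub>v (k \<cdot>\<^sub>v xv (\<omega> * (x + (e - 1) * t * of_real C)) (of_real \<sigma> * (y + (e - 1) * t * of_real S)))"
proof -
  have "U \<in> carrier_mat 2 2" using U(1) by (simp add: unitary_mat_def)
  then obtain \<alpha> \<gamma> \<beta> \<delta> where Ueq: "U = m2 \<alpha> \<gamma> \<beta> \<delta>" by (rule mat_two_cases)
  have col: "\<alpha> = k * ((\<omega> * C + \<sigma> * S) / 2)" "\<beta> = k * ((\<omega> * C - \<sigma> * S) / 2)"
    using U(2) by (simp_all add: Ueq unit_vec_two xv_def)
  \<comment> \<open>Unitarity expresses all products within the unknown second column by the first
    column.\<close>
  have un: "\<gamma> * cnj \<gamma> = 1 - \<alpha> * cnj \<alpha>" "\<gamma> * cnj \<delta> = - (\<alpha> * cnj \<beta>)"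
    "\<delta> * cnj \<gamma> = - (\<beta> * cnj \<alpha>)" "\<delta> * cnj \<delta> = 1 - \<beta> * cnj \<beta>"
    using U(1) by (auto simp: unitary_mat_def Ueq one_mat_two algebra_simps eq_neg_iff_add_eq_0)
  have gen: "U *\<^sub>v (m2 e 0 0 1 *\<^sub>v (mat_adjoint U *\<^sub>v v2 p q)) =
      v2 (p + (e - 1) * (cnj \<alpha> * p + cnj \<beta> * q) * \<alpha>) (q + (e - 1) * (cnj \<alpha> * p + cnj \<beta> * q) * \<beta>)" for p q
  proof -
    have "\<alpha> * (e * (cnj \<alpha> * p + cnj \<beta> * q)) + \<gamma> * (cnj \<gamma> * p + cnj \<delta> * q) =
       e * \<alpha> * (cnj \<alpha> * p + cnj \<beta> * q) + (\<gamma> * cnj \<gamma>) * p + (\<gamma> * cnj \<delta>) * q"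
      by (simp add: algebra_simps)
    moreover have "\<beta> * (e * (cnj \<alpha> * p + cnj \<beta> * q)) + \<delta> * (cnj \<gamma> * p + cnj \<delta> * q) =
       e * \<beta> * (cnj \<alpha> * p + cnj \<beta> * q) + (\<delta> * cnj \<gamma>) * p + (\<delta> * cnj \<delta>) * q"
      by (simp add: algebra_simps)
    ultimately show ?thesis
      unfolding un Ueq by (simp add: algebra_simps)
  qed
  define p where "p = l * (k * ((\<omega> * x + \<sigma> * y) / 2))"
  define q where "q = l * (k * ((\<omega> * x - \<sigma> * y) / 2))"
  have "cnj \<alpha> * p + cnj \<beta> * q = l * (cnj k * k / 2) * ((cnj \<omega> * \<omega>) * C * x + \<sigma>\<^sup>2 * S * y)"
    unfolding col p_def q_def by (simp add: field_simps power2_eq_square)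
  also have "cnj k * k = 2" using k by (metis complex_norm_square mult.commute of_real_numeral)
  also have "cnj \<omega> * \<omega> = 1" by (rule cnj_mult_self[OF \<omega>])
  also have "\<sigma>\<^sup>2 = 1" using \<sigma> by auto
  finally have "cnj \<alpha> * p + cnj \<beta> * q = l * t" by (simp add: t)
  then have "U *\<^sub>v (m2 e 0 0 1 *\<^sub>v (mat_adjoint U *\<^sub>v v2 p q)) =
      v2 (p + (e - 1) * (l * t) * \<alpha>) (q + (e - 1) * (l * t) * \<beta>)"
    by (simp only: gen)
  then show ?thesis
    unfolding p_def q_def col by (simp add: xv_def field_simps)
qed

lemma on_qubit_one: "M \<in> carrier_mat 2 2 \<Longrightarrow> on_qubit (Suc 0) 0 M = M"
  by (subst mat_two_eq_iff) (auto simp: on_qubit_def unset_bit_0 bit_0)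

lemma run_step_one:
  "unitary_mat 2 U \<Longrightarrow> run_step (Suc 0) U (b, 0, W) v = W *\<^sub>v (query_mat U b *\<^sub>v v)"
  using query_mat_unitary[of U b] by (simp add: run_step_alt on_qubit_one unitary_mat_def)

lemma system_state_one: "v \<in> carrier_vec 2 \<Longrightarrow> system_state (Suc 0) v = ketbra v"
  by (subst mat_two_eq_iff) (auto simp: system_state_def ketbra_def)

text \<open>A step queries first and applies its gate afterwards. A block therefore performs
  \<open>U\<close>, the \<open>X\<close> rotation, the adjoint of \<open>U\<close> and the phase
  gate; the \<open>U\<close> completing the conjugation is the first query of whatever
  follows.\<close>

definition grover_block :: "complex \<Rightarrow> complex \<Rightarrow> (bool \<times> nat \<times> complex mat) list" where
  "grover_block u e = [(False, 0, xm 1 u), (True, 0, m2 e 0 0 1)]"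

text \<open>The last lone query supplies the missing \<open>U\<close> of the adjusted block, which
  makes \<open>2 * (m + 1) + 1\<close> queries in all.\<close>

definition amplification_circuit :: "nat \<Rightarrow> complex \<Rightarrow> complex \<Rightarrow> complex \<Rightarrow> complex \<Rightarrow> query_circuit" where
  "amplification_circuit m u e f1 f2 = \<lparr>n_qubits = 1, init_state = unit_vec 2 0, first_gate = 1\<^sub>m 2,
     query_steps = concat (replicate m (grover_block (-1) (-1))) @ grover_block u e @ [(False, 0, xm
         f1 f2)]\<rparr>"

lemma amplification_circuit_wf:
  assumes "cmod u = 1" "cmod e = 1" "cmod f1 = 1" "cmod f2 = 1"
  shows "wf_circuit (amplification_circuit m u e f1 f2)"
    "ancilla_free (amplification_circuit m u e f1 f2)"
    "num_queries (amplification_circuit m u e f1 f2) = 2 * m + 3"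
proof -
  show "ancilla_free (amplification_circuit m u e f1 f2)"
    by (simp add: amplification_circuit_def ancilla_free_def)
  show "num_queries (amplification_circuit m u e f1 f2) = 2 * m + 3"
    by (simp add: amplification_circuit_def num_queries_def grover_block_def length_concat
        sum_list_replicate)
  have "unitary_mat 2 (1\<^sub>m 2)" by (simp add: unitary_mat_def one_mat_two)
  moreover have "unit_vec 2 0 \<bullet>c unit_vec 2 0 = (1 :: complex)"
    by (simp add: unit_vec_two scalar_prod_def sum_atLeastLessThan_two)
  moreover have "unit_vec 2 0 $ i = (0 :: complex)" if "i < 2" "bit i 0" for i
    using that by (auto simp: less_two_iff)
  ultimately show "wf_circuit (amplification_circuit m u e f1 f2)"
    using assms by (auto simp: amplification_circuit_def wf_circuit_def grover_block_def
        xm_unitary phase_gate_unitary)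
qed

text \<open>The state is tracked as \<open>U *\<^sub>v v\<close>, that is after the query that
  follows, because a block stops before its closing \<open>U\<close>.\<close>

lemma fold_grover_block:
  assumes U: "unitary_mat 2 U" "U *\<^sub>v unit_vec 2 0 = k \<cdot>\<^sub>v xv (\<omega> * of_real C) (of_real \<sigma> * of_real S)"
    and k: "(cmod k)\<^sup>2 = 2" and \<omega>: "cmod \<omega> = 1" and \<sigma>: "\<sigma> \<in> {1, -1}"
    and v: "U *\<^sub>v v = l \<cdot>\<^sub>v (k \<cdot>\<^sub>v xv (\<omega> * x) (of_real \<sigma> * y))"
    and t: "t = C * x + S * (u * y)"
  shows "U *\<^sub>v fold (run_step (Suc 0) U) (grover_block u e) v =
     l \<cdot>\<^sub>v (k \<cdot>\<^sub>v xv (\<omega> * (x + (e - 1) * t * of_real C)) (of_real \<sigma> * (u * y + (e - 1) * t * of_real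
         S)))"
proof -
  have "xm 1 u *\<^sub>v (U *\<^sub>v v) = l \<cdot>\<^sub>v (k \<cdot>\<^sub>v xv (\<omega> * x) (of_real \<sigma> * (u * y)))"
    unfolding v smult_smult_assoc xm_mult_smult_xv by (simp add: mult_ac)
  then show ?thesis
    using reflection_xv[OF U k \<omega> \<sigma> t, of e l]
    by (simp add: grover_block_def run_step_one[OF U(1)] query_mat_def)
qed

text \<open>With both phases \<open>-1\<close> a block is a product of two reflections and acts on
  the angle as minus a rotation by \<open>2 * \<theta>\<close>; the signs collect in a global
  factor.\<close>

lemma fold_grover_blocks:
  assumes U: "unitary_mat 2 U" "U *\<^sub>v unit_vec 2 0 = k \<cdot>\<^sub>v xv (\<omega> * of_real (cos \<theta>)) (of_real \<sigma> *
      of_real (sin \<theta>))"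
    and k: "(cmod k)\<^sup>2 = 2" and \<omega>: "cmod \<omega> = 1" and \<sigma>: "\<sigma> \<in> {1, -1}"
  shows "U *\<^sub>v fold (run_step (Suc 0) U) (concat (replicate m (grover_block (-1) (-1)))) (unit_vec 2 0) =
     (- 1) ^ m \<cdot>\<^sub>v (k \<cdot>\<^sub>v xv (\<omega> * of_real (cos (real (2 * m + 1) * \<theta>))) (of_real \<sigma> * of_real (sin
         (real (2 * m + 1) * \<theta>))))"
proof (induction m)
  case 0
  then show ?case using U(2) by simp
next
  case (Suc m)
  define \<phi> where "\<phi> = real (2 * m + 1) * \<theta>"
  define v where "v = fold (run_step (Suc 0) U) (concat (replicate m (grover_block (-1) (-1))))
      (unit_vec 2 0)"
  have "concat (replicate (Suc m) (grover_block (-1) (-1))) =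
      concat (replicate m (grover_block (-1) (-1))) @ grover_block (-1) (-1)"
    by (simp flip: replicate_append_same add: replicate_app_Cons_same[symmetric])
  then have "U *\<^sub>v fold (run_step (Suc 0) U) (concat (replicate (Suc m) (grover_block (-1) (-1))))
      (unit_vec 2 0) =
      U *\<^sub>v fold (run_step (Suc 0) U) (grover_block (-1) (-1)) v"
    by (simp add: v_def)
  also have "\<dots> = (- 1) ^ m \<cdot>\<^sub>v (k \<cdot>\<^sub>v xv
       (\<omega> * (of_real (cos \<phi>) + (- 1 - 1) * of_real (cos (\<phi> + \<theta>)) * of_real (cos \<theta>)))
       (of_real \<sigma> * (- 1 * of_real (sin \<phi>) + (- 1 - 1) * of_real (cos (\<phi> + \<theta>)) * of_real (sin \<theta>))))"
    using Suc.IH unfolding v_def[symmetric] \<phi>_def[symmetric]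
    by (intro fold_grover_block[OF U k \<omega> \<sigma>]) (simp_all add: cos_add mult_ac)
  also have "complex_of_real (cos \<phi>) + (- 1 - 1) * of_real (cos (\<phi> + \<theta>)) * of_real (cos \<theta>) =
      - of_real (cos (\<phi> + 2 * \<theta>))"
  proof -
    have "cos \<phi> - 2 * cos (\<phi> + \<theta>) * cos \<theta> = - cos (\<phi> + 2 * \<theta>)"
      using cos_add[of "\<phi> + \<theta>" \<theta>] cos_diff[of "\<phi> + \<theta>" \<theta>] by (simp add: algebra_simps)
    then show ?thesis by (simp add: complex_eq_iff)
  qed
  also have "- 1 * complex_of_real (sin \<phi>) + (- 1 - 1) * of_real (cos (\<phi> + \<theta>)) * of_real (sin \<theta>) =
      - of_real (sin (\<phi> + 2 * \<theta>))"
  proof -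
    have "- sin \<phi> - 2 * cos (\<phi> + \<theta>) * sin \<theta> = - sin (\<phi> + 2 * \<theta>)"
      using sin_add[of "\<phi> + \<theta>" \<theta>] sin_diff[of "\<phi> + \<theta>" \<theta>] by (simp add: algebra_simps)
    then show ?thesis by (simp add: complex_eq_iff)
  qed
  also have "\<phi> + 2 * \<theta> = real (2 * Suc m + 1) * \<theta>"
    by (simp add: \<phi>_def algebra_simps)
  finally show ?case by (simp add: xv_def algebra_simps)
qed

text \<open>With the phases \<open>f1\<close>, \<open>f2\<close> of the last gate the final state can be turned into the target as
  soon as the moduli of its \<open>X\<close>-basis amplitudes are right; they do not depend on \<open>\<sigma>\<close>.\<close>

lemma amplification_circuit_output:
  fixes u e t f1 f2 p q :: complex and \<theta> :: real
  assumes U: "unitary_mat 2 U" "U *\<^sub>v unit_vec 2 0 = k \<cdot>\<^sub>v xv (\<omega> * of_real (cos \<theta>)) (of_real \<sigma> *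
      of_real (sin \<theta>))"
    and k: "(cmod k)\<^sup>2 = 2" and \<omega>: "cmod \<omega> = 1" and \<sigma>: "\<sigma> \<in> {1, -1}"
    and t: "t = cos \<theta> * cos (real (2 * m + 1) * \<theta>) + sin \<theta> * (u * sin (real (2 * m + 1) * \<theta>))"
    and f1: "f1 * (\<omega> * (of_real (cos (real (2 * m + 1) * \<theta>)) + (e - 1) * t * of_real (cos \<theta>))) = p /
        of_real (sqrt 2)"
    and f2: "f2 * (u * of_real (sin (real (2 * m + 1) * \<theta>)) + (e - 1) * t * of_real (sin \<theta>)) = q /
        of_real (sqrt 2)"
  shows "circuit_output (amplification_circuit m u e f1 f2) U = ketbra (xv p (of_real \<sigma> * q))"
proof -
  define v where "v = fold (run_step (Suc 0) U) (concat (replicate m (grover_block (-1) (-1))))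
      (unit_vec 2 0)"
  define \<phi> where "\<phi> = real (2 * m + 1) * \<theta>"
  have v: "U *\<^sub>v v = (- 1) ^ m \<cdot>\<^sub>v (k \<cdot>\<^sub>v xv (\<omega> * of_real (cos \<phi>)) (of_real \<sigma> * of_real (sin \<phi>)))"
    unfolding v_def \<phi>_def by (rule fold_grover_blocks[OF U k \<omega> \<sigma>])
  have "final_state (amplification_circuit m u e f1 f2) U =
      xm f1 f2 *\<^sub>v (U *\<^sub>v fold (run_step (Suc 0) U) (grover_block u e) v)"
    by (simp add: final_state_def amplification_circuit_def v_def run_step_one[OF U(1)] query_mat_def)
  also have "U *\<^sub>v fold (run_step (Suc 0) U) (grover_block u e) v = (- 1) ^ m \<cdot>\<^sub>v (k \<cdot>\<^sub>v
      xv (\<omega> * (of_real (cos \<phi>) + (e - 1) * t * of_real (cos \<theta>)))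
        (of_real \<sigma> * (u * of_real (sin \<phi>) + (e - 1) * t * of_real (sin \<theta>))))"
    by (rule fold_grover_block[OF U k \<omega> \<sigma> v]) (simp add: t \<phi>_def)
  also have "xm f1 f2 *\<^sub>v \<dots> = ((- 1) ^ m * k) \<cdot>\<^sub>v
      xv (f1 * (\<omega> * (of_real (cos \<phi>) + (e - 1) * t * of_real (cos \<theta>))))
        (of_real \<sigma> * (f2 * (u * of_real (sin \<phi>) + (e - 1) * t * of_real (sin \<theta>))))"
    unfolding smult_smult_assoc xm_mult_smult_xv by (simp add: mult.left_commute[of f2])
  also have "\<dots> = ((- 1) ^ m * k / of_real (sqrt 2)) \<cdot>\<^sub>v xv p (of_real \<sigma> * q)"
    unfolding \<phi>_def f1 f2 by (simp add: xv_def field_simps)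
  finally have "final_state (amplification_circuit m u e f1 f2) U = ((- 1) ^ m * k / of_real (sqrt
      2)) \<cdot>\<^sub>v xv p (of_real \<sigma> * q)" .
  moreover have "cmod ((- 1) ^ m * k / of_real (sqrt 2)) = 1"
  proof -
    have "cmod k = sqrt 2" using k by (metis norm_ge_zero real_sqrt_abs abs_of_nonneg)
    then show ?thesis by (simp add: norm_mult norm_divide norm_power)
  qed
  ultimately show ?thesis
    unfolding circuit_output_def
    by (simp add: amplification_circuit_def system_state_one ketbra_phase)
qed

section \<open>Choice of the phases in the adjusted block\<close>

lemma phase_alignment:
  assumes "cmod a = cmod b"
  obtains f where "cmod f = 1" "f * a = b"
proof (cases "a = 0")
  case True
  then show thesis using assms that[of 1] by simp
next
  case False
  then have "b \<noteq> 0" using assms by auto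
  then show thesis using assms that[of "b / a"] False by (simp add: norm_divide)
qed

text \<open>The new pair is the image of \<open>(a, b)\<close> under the identity plus
  \<open>e - 1\<close> times the projector on \<open>(C, S)\<close>, which is unitary.\<close>

lemma reflection_norm:
  fixes a b e :: complex and C S :: real
  assumes e: "cmod e = 1" and CS: "C\<^sup>2 + S\<^sup>2 = 1" and t: "t = C * a + S * b"
  shows "(cmod (a + (e - 1) * t * C))\<^sup>2 + (cmod (b + (e - 1) * t * S))\<^sup>2 = (cmod a)\<^sup>2 + (cmod b)\<^sup>2"
proof -
  define f where "f = e - 1"
  \<comment> \<open>Restates that \<open>1 + f\<close> has modulus one.\<close>
  have f: "f + cnj f + f * cnj f = 0"
    using cnj_mult_self(2)[OF e] by (simp add: f_def algebra_simps)
  have CS': "complex_of_real C * C + complex_of_real S * S = 1"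
    using CS by (metis of_real_add of_real_mult of_real_1 power2_eq_square)
  have tc: "C * cnj a + S * cnj b = cnj t" by (simp add: t)
  have "complex_of_real ((cmod (a + f * t * C))\<^sup>2 + (cmod (b + f * t * S))\<^sup>2) =
     (a + f * t * C) * cnj (a + f * t * C) + (b + f * t * S) * cnj (b + f * t * S)"
    by (simp add: complex_norm_square del: of_real_power)
  also have "\<dots> = a * cnj a + b * cnj b + f * t * (C * cnj a + S * cnj b) + cnj f * cnj t * (C * a +
      S * b)
      + f * cnj f * (t * cnj t) * (complex_of_real C * C + complex_of_real S * S)"
    by (simp add: algebra_simps)
  also have "\<dots> = a * cnj a + b * cnj b + (t * cnj t) * (f + cnj f + f * cnj f)"
    unfolding CS' tc t[symmetric] by (simp add: algebra_simps)
  also have "\<dots> = complex_of_real ((cmod a)\<^sup>2 + (cmod b)\<^sup>2)"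
    unfolding f by (simp add: complex_norm_square del: of_real_power)
  finally show ?thesis unfolding f_def by (simp only: of_real_eq_iff)
qed

text \<open>Connectedness of the range gives the value whatever the order of \<open>a\<close> and
  \<open>b\<close>; they will be arguments of two phases.\<close>

lemma continuous_attains_between:
  fixes f :: "real \<Rightarrow> real"
  assumes "continuous_on UNIV f" "f a \<le> y" "y \<le> f b"
  obtains x where "f x = y"
proof -
  have "connected (range f)"
    by (intro connected_continuous_image assms(1) connected_UNIV)
  then have "y \<in> range f" 
    using connectedD_interval[of "range f" "f a" "f b" y] assms(2,3) by simp
  then show thesis using that by blast
qed

lemma unit_complex_cis:
  assumes "cmod e = 1" obtains \<phi> where "e = cis \<phi>"
proof -
  have "e \<noteq> 0" using assms by auto
  then have "cis (Arg e) = sgn e" by (rule cis_Arg)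
  also have "sgn e = e" using assms by (simp add: sgn_div_norm)
  finally show thesis using that by metis
qed

text \<open>For fixed \<open>u\<close> the modulus is continuous in the phase \<open>e\<close>, so
  one \<open>e\<close> below and one above \<open>cos \<Theta>\<close> are enough. If
  \<open>\<theta> \<le> \<Theta>\<close>, then \<open>u = -1\<close> works: \<open>e = 1\<close>
  stays at the angle \<open>\<phi>\<close>, and \<open>e = -1\<close> makes the full step to
  \<open>\<phi> + 2 * \<theta>\<close>. Otherwise \<open>\<phi> = \<theta>\<close> overshoots
  \<open>\<Theta>\<close>, and \<open>u\<close> is chosen so that some \<open>e\<close> reaches
  modulus 1.\<close>

lemma last_block_phases:
  fixes \<theta> \<Theta> \<phi> :: real
  assumes \<theta>: "0 < \<theta>" "\<theta> \<le> pi / 4" and \<Theta>: "0 \<le> \<Theta>" "\<Theta> \<le> pi / 4"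
    and \<phi>: "\<theta> \<le> \<phi>" "\<Theta> \<le> \<phi> + 2 * \<theta>" "\<phi> = \<theta> \<or> \<phi> \<le> \<Theta>"
  obtains u e :: complex where "cmod u = 1" "cmod e = 1"
    "cmod (of_real (cos \<phi>) + (e - 1) * (cos \<theta> * cos \<phi> + sin \<theta> * (u * sin \<phi>)) * of_real (cos \<theta>)) = cos \<Theta>"
proof -
  define F where "F = (\<lambda>(u :: complex) (e :: complex). cmod (of_real (cos \<phi>) + (e - 1) * (cos \<theta> *
      cos \<phi> + sin \<theta> * (u * sin \<phi>)) * of_real (cos \<theta>)))"
  note result = that
  have ivt: thesis if u: "cmod u = 1" and e: "cmod e = 1" "cmod e' = 1"
    and F: "F u e \<le> cos \<Theta>" "cos \<Theta> \<le> F u e'" for u e e'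
  proof -
    obtain x x' where x: "e = cis x" "e' = cis x'" using e by (metis unit_complex_cis)
    have "continuous_on UNIV (\<lambda>x. F u (cis x))"
      unfolding F_def cis_conv_exp by (intro continuous_intros)
    then obtain y where "F u (cis y) = cos \<Theta>"
      using continuous_attains_between[of "\<lambda>x. F u (cis x)" x "cos \<Theta>" x'] F x by auto
    then show thesis using result[of u "cis y"] u by (simp add: F_def)
  qed
  have C: "0 < cos \<theta>" using \<theta> by (intro cos_gt_zero_pi) auto
  have S: "0 < sin \<theta>" using \<theta> by (intro sin_gt_zero) auto
  show thesis
  proof (cases "\<theta> \<le> \<Theta>")
    case True
    then have le: "\<phi> \<le> \<Theta>" using \<phi>(3) by auto
    have "F (-1) (-1) = \<bar>cos (\<phi> + 2 * \<theta>)\<bar>"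
    proof -
      have "cos \<phi> - 2 * (cos \<theta> * cos \<phi> - sin \<theta> * sin \<phi>) * cos \<theta> = - cos (\<phi> + 2 * \<theta>)"
        using cos_add[of "\<phi> + \<theta>" \<theta>] cos_diff[of "\<phi> + \<theta>" \<theta>] cos_add[of \<phi> \<theta>] by (simp add: algebra_simps)
      then have "complex_of_real (cos \<phi>) + (-1 - 1) * (of_real (cos \<theta> * cos \<phi>) + of_real (sin \<theta>) *
          (-1 * of_real (sin \<phi>))) * of_real (cos \<theta>)
          = of_real (- cos (\<phi> + 2 * \<theta>))"
        by (simp add: complex_eq_iff algebra_simps)
      then show ?thesis unfolding F_def by (simp only: norm_of_real abs_minus_cancel)
    qed
    also have "\<dots> \<le> cos \<Theta>"
    proof (rule abs_leI)
      show "cos (\<phi> + 2 * \<theta>) \<le> cos \<Theta>"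
        using \<phi>(2) le True \<theta> \<Theta> by (intro cos_monotone_0_pi_le) auto
      \<comment> \<open>The angle may pass \<open>pi / 2\<close>, but it is at most
        \<open>3 * pi / 4\<close> and hence at most \<open>pi - \<Theta>\<close>.\<close>
      have "cos (pi - (\<phi> + 2 * \<theta>)) \<le> cos \<Theta>"
        using \<phi>(2) le True \<theta> \<Theta> \<phi>(1) by (intro cos_monotone_0_pi_le) auto
      then show "- cos (\<phi> + 2 * \<theta>) \<le> cos \<Theta>" by (simp add: cos_diff)
    qed
    finally have "F (-1) (-1) \<le> cos \<Theta>" .
    moreover have "cos \<Theta> \<le> F (-1) 1"
    proof -
      have "cos \<Theta> \<le> cos \<phi>" using le \<phi>(1) \<theta> \<Theta> by (intro cos_monotone_0_pi_le) auto
      also have "\<dots> \<le> F (-1) 1" by (simp add: F_def)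
      finally show ?thesis .
    qed
    ultimately show thesis by (intro ivt[of "-1" "-1" 1]) auto
  next
    case False
    then have \<phi>\<theta>: "\<phi> = \<theta>" using \<phi> by auto
    define c s where "c = cos \<theta>" and "s = sin \<theta>"
    have cs: "c\<^sup>2 + s\<^sup>2 = 1" by (simp add: c_def s_def)
    have c0: "c > 0" and s0: "s > 0" using C S by (simp_all add: c_def s_def)
    have "s \<le> c"
    proof -
      have "sin \<theta> = cos (pi / 2 - \<theta>)" by (simp add: sin_cos_eq)
      also have "\<dots> \<le> cos \<theta>" using \<theta> by (intro cos_monotone_0_pi_le) auto
      finally show ?thesis by (simp add: c_def s_def)
    qed
    then have "s\<^sup>2 \<le> c\<^sup>2" using s0 by (intro power_mono) auto
    then have c2: "1 \<le> 2 * c\<^sup>2" using cs by linarith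
    txt \<open>This \<open>\<kappa>\<close> is the cosine of the \<open>X\<close> rotation angle for which the rotated state and the \<open>X = 1\<close>
      eigenvector have equal overlap with \<open>U |0>\<close>, so that a rotation about \<open>U |0>\<close> joins them.\<close>
    define \<kappa> where "\<kappa> = 1 - 1 / (2 * c\<^sup>2)"
    have \<kappa>: "0 \<le> \<kappa>" "\<kappa> \<le> 1" using c2 c0 by (auto simp: \<kappa>_def)
    then have \<kappa>2: "\<kappa>\<^sup>2 \<le> 1" by (simp add: power_le_one)
    define u where "u = Complex \<kappa> (sqrt (1 - \<kappa>\<^sup>2))"
    have u: "cmod u = 1" using \<kappa>2 by (simp add: u_def cmod_def)
    \<comment> \<open>The overlap with \<open>U |0>\<close> after the \<open>X\<close> rotation; the
      choice of \<open>\<kappa>\<close> gives it modulus \<open>c\<close>, like the overlap of the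
      eigenvector.\<close>
    define w where "w = complex_of_real (c\<^sup>2) + of_real (s\<^sup>2) * u"
    have wn: "cmod w = c"
    proof -
      have "(cmod w)\<^sup>2 = (c\<^sup>2 + s\<^sup>2 * \<kappa>)\<^sup>2 + (s\<^sup>2)\<^sup>2 * (1 - \<kappa>\<^sup>2)"
        using \<kappa>2 by (simp add: w_def u_def cmod_power2 power_mult_distrib)
      also have "\<dots> = (c\<^sup>2 + s\<^sup>2)\<^sup>2 - 2 * c\<^sup>2 * s\<^sup>2 * (1 - \<kappa>)"
        by (simp add: power2_eq_square algebra_simps)
      also have "\<dots> = 1 - s\<^sup>2" using c0 by (simp add: cs \<kappa>_def)
      also have "\<dots> = c\<^sup>2" using cs by linarith
      finally show ?thesis using c0 by simp
    qed
    have "1 - w = of_real (s\<^sup>2) * (1 - u)"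
    proof -
      have "(1 :: complex) = of_real (c\<^sup>2 + s\<^sup>2)" by (simp add: cs)
      then show ?thesis by (simp add: w_def algebra_simps)
    qed
    moreover have "cmod (1 - u) = 1 / c"
    proof -
      have "(cmod (1 - u))\<^sup>2 = (1 - \<kappa>)\<^sup>2 + (1 - \<kappa>\<^sup>2)" using \<kappa>2 by (simp add: u_def cmod_power2)
      also have "\<dots> = 2 * (1 - \<kappa>)" by (simp add: power2_eq_square algebra_simps)
      also have "\<dots> = (1 / c)\<^sup>2" by (simp add: \<kappa>_def power_divide)
      finally show ?thesis using c0 by simp
    qed
    ultimately have w1: "cmod (1 - w) = s\<^sup>2 / c" by (simp add: norm_mult norm_power)
    have Fw: "F u e = cmod ((1 - w) + e * w) * c" for e
    proof -
      have "of_real (cos \<phi>) + (e - 1) * (cos \<theta> * cos \<phi> + sin \<theta> * (u * sin \<phi>)) * of_real (cos \<theta>)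
          = ((1 - w) + e * w) * of_real c"
        by (simp add: \<phi>\<theta> w_def c_def s_def algebra_simps power2_eq_square)
      then show ?thesis unfolding F_def using c0 by (simp add: norm_mult)
    qed
    \<comment> \<open>Aligns \<open>e * w\<close> with \<open>1 - w\<close>, so that their moduli
      add up to \<open>1 / c\<close>.\<close>
    define e where "e = ((1 - w) / of_real (s\<^sup>2 / c)) / (w / of_real c)"
    have e1: "cmod e = 1"
      unfolding e_def using w1 wn c0 s0 by (simp add: norm_divide norm_mult norm_power)
    have "w \<noteq> 0" using wn c0 by auto
    then have "(1 - w) + e * w = (1 - w) * of_real (1 + c / (s\<^sup>2 / c))"
      using c0 s0 by (simp add: e_def field_simps)
    then have "cmod ((1 - w) + e * w) = cmod (1 - w) * (1 + c / (s\<^sup>2 / c))"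
      using c0 by (simp only: norm_mult norm_of_real) (simp add: add_nonneg_nonneg)
    also have "\<dots> = (s\<^sup>2 + c\<^sup>2) / c"
      unfolding w1 using c0 s0 by (simp add: field_simps power2_eq_square)
    finally have "F u e = 1" using cs c0 by (simp add: Fw add.commute)
    moreover have "F u 1 \<le> cos \<Theta>"
      using False \<theta> \<Theta> unfolding Fw c_def by (simp add: cos_monotone_0_pi_le)
    ultimately show thesis using u e1 by (intro ivt[of u 1 e]) auto
  qed
qed

section \<open>Angles and query count\<close>

lemma half_angle_exists:
  fixes s :: real
  assumes "0 < s" "s \<le> 1"
  obtains \<theta> where "0 < \<theta>" "\<theta> \<le> pi / 4" "sin \<theta> = s / sqrt 2"
proof
  have s: "0 < s / sqrt 2" "s / sqrt 2 \<le> sin (pi / 4)" "s / sqrt 2 \<le> 1"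
    using assms order_trans[OF assms(2), of "sqrt 2"] by (auto simp: sin_45 field_simps)
  show "sin (arcsin (s / sqrt 2)) = s / sqrt 2" using s by (intro sin_arcsin) auto
  show "0 < arcsin (s / sqrt 2)" using s arcsin_less_arcsin[of 0 "s / sqrt 2"] by simp
  have "arcsin (s / sqrt 2) \<le> arcsin (sin (pi / 4))" using s by (intro arcsin_le_arcsin) auto
  then show "arcsin (s / sqrt 2) \<le> pi / 4" by (simp add: arcsin_sin)
qed

text \<open>By concavity the sine lies above its chord on the interval from 0 to
  \<open>pi / 4\<close>. The inverse slope of the chord is one third of the constant
  \<open>3 * pi / (2 * sqrt 2)\<close>.\<close>

lemma angle_le_sin:
  fixes x :: real
  assumes "0 \<le> x" "x \<le> pi / 4"
  shows "x \<le> pi * sqrt 2 / 4 * sin x"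
proof -
  have "concave_on {0..pi} sin"
    by (rule f''_le0_imp_concave[where f' = cos and f'' = "\<lambda>x. - sin x"])
      (auto intro!: derivative_eq_intros sin_ge_zero)
  then have "(1 - 4 * x / pi) * sin 0 + (4 * x / pi) * sin (pi / 4)
      \<le> sin ((1 - 4 * x / pi) *\<^sub>R 0 + (4 * x / pi) *\<^sub>R (pi / 4))"
    using assms by (intro concave_onD) (auto simp: field_simps)
  then have "4 * x / pi * (sqrt 2 / 2) \<le> sin x" by (simp add: sin_45)
  then have "pi * sqrt 2 / 4 * (4 * x / pi * (sqrt 2 / 2)) \<le> pi * sqrt 2 / 4 * sin x"
    by (intro mult_left_mono) auto
  then show ?thesis by simp
qed

text \<open>Shows that 1 / cosh grows along the evolution at most by the factor
  \<open>exp (g * T / 2)\<close>, uniformly in the starting point.\<close>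

lemma cosh_shift_le:
  fixes a h :: real
  assumes "0 \<le> h"
  shows "cosh a \<le> exp h * cosh (a - h)"
proof -
  have "exp (- a) \<le> exp h * exp (h - a)" using assms by (simp flip: exp_add)
  moreover have "exp h * exp (a - h) = exp a" by (simp flip: exp_add)
  ultimately show ?thesis by (simp add: cosh_def algebra_simps)
qed

text \<open>The circuit is fixed before \<open>\<sigma>\<close>, \<open>\<phi>\<close> and
  \<open>U\<close>: one circuit serves both signs, every global phase and every completion of the
  oracle.\<close>

lemma gp_circuit_exists:
  fixes g T \<xi> :: real
  assumes g: "g > 0" and T: "T > 0" and \<xi>: "0 < \<xi>" "\<xi> < 1"
  obtains C where "wf_circuit C" "ancilla_free C"
    "real (num_queries C) \<le> 3 * pi / (2 * sqrt 2) * exp (g * T / 2)"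
    "\<And>\<sigma> \<phi> U. \<sigma> \<in> {1, -1} \<Longrightarrow> \<phi> \<in> carrier_vec 2 \<Longrightarrow> ketbra \<phi> = bloch_state (initial_bloch \<sigma> \<xi>) \<Longrightarrow>
       oracle_for \<phi> U \<Longrightarrow> circuit_output C U = gp_state g \<phi> T"
proof -
  define a0 where "a0 = arcosh (1 / sqrt \<xi>)"
  define aT where "aT = a0 - g * T / 2"
  have "1 \<le> 1 / sqrt \<xi>" using \<xi> by (simp add: real_le_lsqrt)
  then have a0: "cosh a0 = 1 / sqrt \<xi>" "0 \<le> a0" by (simp_all add: a0_def arcosh_nonneg_real)
  have sech: "0 < 1 / cosh x" "1 / cosh x \<le> 1" for x :: real
    using cosh_real_ge_1[of x] cosh_real_pos[of x] by (auto simp: field_simps)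
  obtain \<theta> where \<theta>: "0 < \<theta>" "\<theta> \<le> pi / 4" "sin \<theta> = 1 / cosh a0 / sqrt 2"
    using half_angle_exists[OF sech] .
  obtain \<Theta> where \<Theta>: "0 < \<Theta>" "\<Theta> \<le> pi / 4" "sin \<Theta> = 1 / cosh aT / sqrt 2"
    using half_angle_exists[OF sech] .
  have cosn: "cmod (1 + \<i> * of_real (tanh x)) = sqrt 2 * cos y" if "sin y = 1 / cosh x / sqrt 2" "0
      < y" "y \<le> pi / 4" for x y :: real
  proof -
    have "(cmod (1 + \<i> * of_real (tanh x)))\<^sup>2 = 1 + (tanh x)\<^sup>2" by (simp add: cmod_power2)
    also have "\<dots> = 2 * (1 - (1 / cosh x / sqrt 2)\<^sup>2)"
      using tanh_sech_squared[of x] by (simp add: power_divide power_mult_distrib)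
    also have "\<dots> = (sqrt 2 * cos y)\<^sup>2"
      unfolding that(1)[symmetric] by (simp add: power_mult_distrib cos_squared_eq)
    finally show ?thesis using that cos_ge_zero[of y] by (simp add: power2_eq_iff_nonneg)
  qed
  \<comment> \<open>An upper bound for the ratio of \<open>\<Theta>\<close> to
    \<open>\<theta>\<close>.\<close>
  define B where "B = pi * sqrt 2 / 4 * exp (g * T / 2)"
  have B3: "3 * pi / (2 * sqrt 2) * exp (g * T / 2) = 3 * B"
    by (simp add: B_def field_simps)
  have B1: "1 \<le> B"
  proof -
    have "1 * 1 \<le> (pi * sqrt 2 / 4) * exp (g * T / 2)"
    proof (rule mult_mono)
      have "sqrt 2 / 2 \<le> pi / 4"
        using sin_x_le_x[of "pi / 4"] by (simp add: sin_45)
      then have "sqrt 2 * (sqrt 2 / 2) \<le> sqrt 2 * (pi / 4)" by (intro mult_left_mono) auto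
      then show "1 \<le> pi * sqrt 2 / 4" by (simp add: mult.commute)
    qed (use g T in auto)
    then show ?thesis by (simp add: B_def)
  qed
  have ratio: "\<Theta> \<le> B * \<theta>"
  proof -
    have "\<Theta> \<le> pi * sqrt 2 / 4 * sin \<Theta>" using \<Theta> by (intro angle_le_sin) auto
    also have "sin \<Theta> \<le> exp (g * T / 2) * sin \<theta>"
    proof -
      have "cosh a0 \<le> exp (g * T / 2) * cosh aT"
        unfolding aT_def using g T by (intro cosh_shift_le) simp
      then have "1 / cosh aT \<le> exp (g * T / 2) / cosh a0"
        by (simp add: field_simps)
      then show ?thesis 
        using divide_right_mono[of _ _ "sqrt 2"] unfolding \<theta>(3) \<Theta>(3) by fastforce
    qed
    also have "sin \<theta> \<le> \<theta>" using \<theta> by (intro sin_x_le_x) auto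
    finally show ?thesis by (simp add: B_def mult_ac mult_left_mono)
  qed
  \<comment> \<open>The standard blocks reach \<open>(2 * m + 1) * \<theta>\<close>, and the
    adjusted block can extend this to \<open>(2 * m + 3) * \<theta>\<close>; \<open>m\<close> is the
    least number that brings \<open>\<Theta>\<close> within reach.\<close>
  define m where "m = (LEAST m::nat. \<Theta> \<le> real (2 * m + 3) * \<theta>)"
  have "\<exists>m::nat. \<Theta> \<le> real (2 * m + 3) * \<theta>"
  proof -
    obtain m :: nat where "\<Theta> / \<theta> \<le> m" using real_arch_simple by blast
    then have "\<Theta> \<le> m * \<theta>" using \<theta> by (simp add: field_simps)
    also have "\<dots> \<le> real (2 * m + 3) * \<theta>" using \<theta> by (intro mult_right_mono) auto
    finally show ?thesis by blast
  qed
  then have m: "\<Theta> \<le> real (2 * m + 3) * \<theta>" unfolding m_def by (rule LeastI_ex)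
  have m': "real (2 * m + 1) * \<theta> \<le> \<Theta>" if "m \<noteq> 0"
  proof -
    have "m - 1 < m" using that by simp
    then have "\<not> \<Theta> \<le> real (2 * (m - 1) + 3) * \<theta>" unfolding m_def by (rule not_less_Least)
    then show ?thesis using that by (simp add: of_nat_diff algebra_simps)
  qed
  \<comment> \<open>Origin of the factor 3: for positive \<open>m\<close> minimality gives
    \<open>2 * m + 1 \<le> B\<close>, and the two further queries cost at most \<open>2 * B\<close>;
    for \<open>m = 0\<close> there are three queries.\<close>
  have count: "real (2 * m + 3) \<le> 3 * B"
  proof (cases "m = 0")
    case False
    then have "real (2 * m + 1) * \<theta> \<le> B * \<theta>" using m' ratio by simp
    then have "2 * m + 1 \<le> B" using \<theta> by simp
    then show ?thesis using B1 by simp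
  qed (use B1 in simp)
  define \<phi> where "\<phi> = real (2 * m + 1) * \<theta>"
  have "\<theta> \<le> \<phi>" using \<theta> by (simp add: \<phi>_def)
  moreover have "\<Theta> \<le> \<phi> + 2 * \<theta>" using m by (simp add: \<phi>_def algebra_simps)
  moreover have "\<phi> = \<theta> \<or> \<phi> \<le> \<Theta>" using m' by (auto simp: \<phi>_def)
  ultimately obtain u e :: complex where u: "cmod u = 1" and e: "cmod e = 1" and
    ue: "cmod (of_real (cos \<phi>) + (e - 1) * (cos \<theta> * cos \<phi> + sin \<theta> * (u * sin \<phi>)) * of_real (cos \<theta>))
        = cos \<Theta>"
    using last_block_phases[of \<theta> \<Theta> \<phi>] \<theta> \<Theta> by (metis less_imp_le)
  define t where "t = cos \<theta> * cos \<phi> + sin \<theta> * (u * sin \<phi>)"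
  \<comment> \<open>As the block preserves the norm, the second modulus follows from the
    first.\<close>
  have "(cmod (of_real (cos \<phi>) + (e - 1) * t * of_real (cos \<theta>)))\<^sup>2 +
      (cmod (u * of_real (sin \<phi>) + (e - 1) * t * of_real (sin \<theta>)))\<^sup>2 =
      (cmod (of_real (cos \<phi>)))\<^sup>2 + (cmod (u * of_real (sin \<phi>)))\<^sup>2"
    by (rule reflection_norm[OF e]) (simp_all add: t_def)
  then have "(cmod (u * of_real (sin \<phi>) + (e - 1) * t * of_real (sin \<theta>)))\<^sup>2 = (sin \<Theta>)\<^sup>2"
    using ue u unfolding t_def[symmetric] by (simp add: norm_mult sin_squared_eq)
  then have ue': "cmod (u * of_real (sin \<phi>) + (e - 1) * t * of_real (sin \<theta>)) = sin \<Theta>"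
    using \<Theta> sin_gt_zero[of \<Theta>] by (simp add: power2_eq_iff_nonneg)
  \<comment> \<open>The phase of the initial \<open>X = 1\<close> amplitude relative to
    \<open>gp_vec\<close>. It is the same for both signs, so \<open>f1\<close> can absorb
    it.\<close>
  define \<omega> where "\<omega> = (1 + \<i> * of_real (tanh a0)) / of_real (sqrt 2 * cos \<theta>)"
  have cos0: "cos \<theta> > 0" using \<theta> by (intro cos_gt_zero_pi) auto
  have \<omega>: "cmod \<omega> = 1"
    unfolding \<omega>_def norm_divide cosn[OF \<theta>(3,1,2)] using cos0 by (simp add: norm_mult)
  obtain f1 where f1: "cmod f1 = 1"
    "f1 * (\<omega> * (of_real (cos \<phi>) + (e - 1) * t * of_real (cos \<theta>))) = (1 + \<i> * of_real (tanh aT)) /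
        of_real (sqrt 2)"
  proof (rule phase_alignment)
    show "cmod (\<omega> * (of_real (cos \<phi>) + (e - 1) * t * of_real (cos \<theta>))) = cmod ((1 + \<i> * of_real
        (tanh aT)) / of_real (sqrt 2))"
      unfolding norm_mult[of \<omega>] norm_divide cosn[OF \<Theta>(3,1,2)] using ue \<omega> by (simp add: t_def)
  qed
  obtain f2 where f2: "cmod f2 = 1"
    "f2 * (u * of_real (sin \<phi>) + (e - 1) * t * of_real (sin \<theta>)) = of_real (1 / cosh aT) / of_real
        (sqrt 2)"
  proof (rule phase_alignment)
    show "cmod (u * of_real (sin \<phi>) + (e - 1) * t * of_real (sin \<theta>)) = cmod (of_real (1 / cosh aT) /
        of_real (sqrt 2))"
      unfolding ue' \<Theta>(3) using sech(1)[of aT] by (simp add: norm_divide norm_mult)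
  qed
  define C where "C = amplification_circuit m u e f1 f2"
  note C = amplification_circuit_wf[OF u e f1(1) f2(1), of m, folded C_def]
  show thesis
  proof (rule that[OF C(1,2)])
    show "real (num_queries C) \<le> 3 * pi / (2 * sqrt 2) * exp (g * T / 2)"
      unfolding C(3) B3 by (rule count)
    fix \<sigma> :: real and \<psi> U
    assume \<sigma>: "\<sigma> \<in> {1, -1}" and \<psi>: "\<psi> \<in> carrier_vec 2" "ketbra \<psi> = bloch_state (initial_bloch \<sigma> \<xi>)"
      and U: "oracle_for \<psi> U"
    obtain c where c: "cmod c = 1" "\<psi> = c \<cdot>\<^sub>v gp_vec \<sigma> a0"
      using initial_state_eq_gp_vec[OF \<sigma> \<xi> a0(2,1) \<psi>] .
    have "gp_vec \<sigma> a0 = of_real (sqrt 2) \<cdot>\<^sub>v xv (\<omega> * of_real (cos \<theta>)) (of_real \<sigma> * of_real (sin \<theta>))"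
      using cos0 unfolding gp_vec_xv \<theta>(3) \<omega>_def by (simp add: xv_def field_simps)
    then have "U *\<^sub>v unit_vec 2 0 = (c * of_real (sqrt 2)) \<cdot>\<^sub>v xv (\<omega> * of_real (cos \<theta>)) (of_real \<sigma> *
        of_real (sin \<theta>))"
      using U c by (simp add: oracle_for_def smult_smult_assoc)
    then have "circuit_output C U = ketbra (xv (1 + \<i> * of_real (tanh aT)) (of_real \<sigma> * of_real (1 /
        cosh aT)))"
      unfolding C_def
      using U c(1) \<omega> \<sigma> f1(2) f2(2)
      by (intro amplification_circuit_output[where k = "c * of_real (sqrt 2)" and \<omega> = \<omega> and \<theta> = \<theta>
          and t = t])
        (auto simp: oracle_for_def norm_mult t_def \<phi>_def)
    also have "\<dots> = gp_state g \<psi> T"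
      unfolding c(2) using gp_state_gp_vec[OF g \<sigma> c(1), of T a0] T
      by (simp add: aT_def gp_vec_xv)
    finally show "circuit_output C U = gp_state g \<psi> T" .
  qed
qed

section \<open>Lower bound\<close>

text \<open>The second column is the canonical orthogonal complement of the first with the same
  phase \<open>c\<close>; it makes the oracles for opposite signs close as operators, not only on
  \<open>|0>\<close>.\<close>

definition coherent_oracle :: "complex \<Rightarrow> real \<Rightarrow> real \<Rightarrow> complex mat" where
  "coherent_oracle c \<sigma> a = (let x = gp_vec \<sigma> a $ 0; y = gp_vec \<sigma> a $ Suc 0
     in m2 (c * x) (- (c * cnj y)) (c * y) (c * cnj x))"

lemma coherent_oracle_unitary:
  assumes "cmod c = 1" "\<sigma> \<in> {1, -1}"
  shows "unitary_mat 2 (coherent_oracle c \<sigma> a)"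
proof -
  define x where "x = gp_vec \<sigma> a $ 0"
  define y where "y = gp_vec \<sigma> a $ Suc 0"
  have gp: "gp_vec \<sigma> a = v2 x y" by (simp add: vec_two_eq_iff x_def y_def)
  note c = cnj_mult_self(1)[OF assms(1)]
  have c': "cnj c * (c * z) = z" "c * (cnj c * z) = z" for z
    using c by (simp_all flip: mult.assoc add: mult.commute)
  have c'': "c * (w * (cnj c * z)) = w * z" for w z
    using c'(2) by (simp add: mult.left_commute[of c w])
  have xy: "x * cnj x + y * cnj y = 1"
  proof -
    have "x * cnj x * 2 = 1 + \<sigma> / cosh a" "y * cnj y * 2 = 1 - \<sigma> / cosh a"
      using ketbra_gp_vec[OF assms(2), of a] unfolding gp by (simp_all add: bloch_state_m2)
    then have "(x * cnj x + y * cnj y) * 2 = 1 * 2" by (simp add: distrib_right)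
    then show ?thesis by (simp only: mult_cancel_right) simp
  qed
  have "unitary_mat 2 (m2 (c * x) (- (c * cnj y)) (c * y) (c * cnj x))"
    using xy c by (simp add: unitary_mat_def one_mat_two mult_ac c' c'' add.commute)
  then show ?thesis by (simp add: coherent_oracle_def Let_def x_def y_def)
qed

lemma coherent_oracle_for:
  "oracle_for (c \<cdot>\<^sub>v gp_vec \<sigma> a) (coherent_oracle c \<sigma> a)"
  if "cmod c = 1" "\<sigma> \<in> {1, -1}"
  using coherent_oracle_unitary[OF that, of a]
  by (simp add: oracle_for_def coherent_oracle_def Let_def unit_vec_two vec_two_eq_iff
      carrier_vecD[OF gp_vec_carrier])

text \<open>Once the phase is matched, only the terms \<open>s\<close> and \<open>- s\<close>
  differ. \<open>M\<close> is then, up to a phase, \<open>s\<close> times a matrix with entries 1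
  and -1 and orthogonal columns, hence \<open>sqrt 2 * s\<close> times a unitary.\<close>

lemma coherent_oracle_near:
  assumes "cmod c = 1" "cmod c' = 1"
  shows "\<exists>M e. cmod e = 1 \<and> M \<in> carrier_mat 2 2 \<and>
    mat_adjoint M * M = of_real ((sqrt 2 / cosh a)\<^sup>2) \<cdot>\<^sub>m 1\<^sub>m 2 \<and>
    query_mat (coherent_oracle c 1 a) b = M + e \<cdot>\<^sub>m query_mat (coherent_oracle c' (- 1) a) b"
proof -
  define s where "s = complex_of_real (1 / cosh a)"
  define e where "e = (if b then cnj (c / c') else c / c')"
  define M where "M = (if b then m2 (cnj c * s) (- cnj c * s) (cnj c * s) (cnj c * s)
     else m2 (c * s) (c * s) (- c * s) (c * s))"
  note c = cnj_mult_self(2)[OF assms(1)]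
  have cc: "c * (s * (cnj c * s)) = s\<^sup>2" "cnj c * (s * (c * s)) = s\<^sup>2"
  proof -
    have "c * (s * (cnj c * s)) = (c * cnj c) * s\<^sup>2" "cnj c * (s * (c * s)) = (c * cnj c) * s\<^sup>2"
      by (simp_all add: power2_eq_square)
    then show "c * (s * (cnj c * s)) = s\<^sup>2" "cnj c * (s * (c * s)) = s\<^sup>2" by (simp_all add: c)
  qed
  have c0: "c' \<noteq> 0" "cnj c' \<noteq> 0" using assms(2) by auto
  have s2: "of_real ((sqrt 2 / cosh a)\<^sup>2) = s\<^sup>2 + s\<^sup>2" by (simp add: s_def power_divide)
  have cs: "cnj s = s" by (simp add: s_def)
  have "mat_adjoint M * M = of_real ((sqrt 2 / cosh a)\<^sup>2) \<cdot>\<^sub>m 1\<^sub>m 2"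
    unfolding s2 by (simp add: M_def one_mat_two cs mult.assoc cc)
  moreover have "query_mat (coherent_oracle c 1 a) b = M + e \<cdot>\<^sub>m query_mat (coherent_oracle c' (- 1)
      a) b"
    using c0 by (simp add: query_mat_def coherent_oracle_def gp_vec_def M_def e_def s_def field_simps)
  moreover have "cmod e = 1" using assms by (simp add: e_def norm_divide)
  ultimately show ?thesis by (intro exI[of _ M] exI[of _ e]) (simp add: M_def)
qed

text \<open>For this \<open>\<xi>\<close> the trajectories start at \<open>a = g * T / 2\<close> and
  end at 0, where the targets are the two basis states. Accuracy puts the \<open>(0, 0)\<close>
  entries within \<open>\<epsilon> / 2\<close> of 1 and 0, so they differ by at least
  \<open>1 - \<epsilon>\<close>, whereas \<open>q\<close> queries allow at most
  \<open>2 * sqrt 2 * q / cosh a\<close>.\<close>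

lemma query_lower_bound:
  assumes A: "solves \<psi>0 A" and init: "initial_states \<psi>0" and g: "g > 0" and T: "T > 0"
    and \<epsilon>: "0 < \<epsilon>" "\<epsilon> < 1"
  shows "(1 - \<epsilon>) / (2 * sqrt 2) * cosh (g * T / 2) \<le> num_queries (A g T ((1 / cosh (g * T / 2))\<^sup>2) \<epsilon>)"
proof -
  define a where "a = g * T / 2"
  have a: "a > 0" using g T by (simp add: a_def)
  have "cosh a > 1" using a cosh_real_strict_mono[of 0 a] by simp
  define \<xi> where "\<xi> = (1 / cosh a)\<^sup>2"
  have \<xi>: "0 < \<xi>" "\<xi> < 1" using \<open>cosh a > 1\<close> by (auto simp: \<xi>_def power_divide)
  have ca: "cosh a = 1 / sqrt \<xi>" using \<open>cosh a > 1\<close> by (simp add: \<xi>_def real_sqrt_divide)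
  define C where "C = A g T \<xi> \<epsilon>"
  have wf: "wf_circuit C"
    and good: "\<And>\<sigma> U. \<sigma> \<in> {1, -1} \<Longrightarrow> oracle_for (\<psi>0 \<sigma> \<xi>) U \<Longrightarrow>
        trace_norm (circuit_output C U - gp_state g (\<psi>0 \<sigma> \<xi>) T) \<le> \<epsilon>"
    using A g T \<xi> \<epsilon> by (auto simp: solves_def C_def)
  have phase: "\<exists>c. cmod c = 1 \<and> \<psi>0 \<sigma> \<xi> = c \<cdot>\<^sub>v gp_vec \<sigma> a" if \<sigma>: "\<sigma> \<in> {1, -1}" for \<sigma>
  proof -
    have "\<psi>0 \<sigma> \<xi> \<in> carrier_vec 2" "ketbra (\<psi>0 \<sigma> \<xi>) = bloch_state (initial_bloch \<sigma> \<xi>)"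
      using init \<sigma> \<xi> by (auto simp: initial_states_def)
    then show ?thesis
      using initial_state_eq_gp_vec[OF \<sigma> \<xi> _ ca] a by (metis less_imp_le)
  qed
  obtain c c' where c: "cmod c = 1" "\<psi>0 1 \<xi> = c \<cdot>\<^sub>v gp_vec 1 a"
    and c': "cmod c' = 1" "\<psi>0 (- 1) \<xi> = c' \<cdot>\<^sub>v gp_vec (- 1) a"
    using phase[of 1] phase[of "- 1"] by auto
  define U where "U = coherent_oracle c 1 a"
  define V where "V = coherent_oracle c' (- 1) a"
  have U: "unitary_mat 2 U" "oracle_for (\<psi>0 1 \<xi>) U"
    unfolding U_def c(2) using c(1) by (auto intro!: coherent_oracle_unitary coherent_oracle_for)
  have V: "unitary_mat 2 V" "oracle_for (\<psi>0 (- 1) \<xi>) V"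
    unfolding V_def c'(2) using c'(1) by (auto intro!: coherent_oracle_unitary coherent_oracle_for)
  \<comment> \<open>The final Bloch vector is \<open>(0, 0, \<sigma>)\<close>.\<close>
  have "gp_state g (\<psi>0 \<sigma> \<xi>) T = m2 (of_real ((1 + \<sigma>) / 2)) 0 0 (of_real ((1 - \<sigma>) / 2))"
    if \<sigma>: "\<sigma> \<in> {1, -1}" for \<sigma>
  proof -
    obtain d where d: "cmod d = 1" "\<psi>0 \<sigma> \<xi> = d \<cdot>\<^sub>v gp_vec \<sigma> a" using phase[OF \<sigma>] by blast
    have "gp_state g (\<psi>0 \<sigma> \<xi>) T = ketbra (gp_vec \<sigma> (a - g * T / 2))"
      unfolding d(2) using g \<sigma> d(1) T by (intro gp_state_gp_vec) auto
    then show ?thesis by (simp add: a_def ketbra_gp_vec[OF \<sigma>] bloch_state_m2)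
  qed
  note target = this
  have close: "2 * \<bar>Re (circuit_output C W $$ (0, 0)) - (1 + \<sigma>) / 2\<bar> \<le> \<epsilon>"
    if \<sigma>: "\<sigma> \<in> {1, -1}" and W: "unitary_mat 2 W" "oracle_for (\<psi>0 \<sigma> \<xi>) W" for \<sigma> W
  proof -
    let ?D = "circuit_output C W - gp_state g (\<psi>0 \<sigma> \<xi>) T"
    note out = circuit_output_hermitian_trace[OF wf W(1)]
    obtain p q r s where O: "circuit_output C W = m2 p q r s" using out(1) by (rule mat_two_cases)
    have s: "s = 1 - p" using out(3) by (simp add: O mat_trace_def sum_lessThan_two algebra_simps)
    have "?D \<in> carrier_mat 2 2" "mat_adjoint ?D = ?D"
      using out(2) unfolding O target[OF \<sigma>] by simp_all
    moreover have "mat_trace ?D = 0"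
      unfolding O target[OF \<sigma>]
      by (simp add: s mat_trace_def sum_lessThan_two diff_divide_distrib add_divide_distrib)
    ultimately have "2 * \<bar>Re (?D $$ (0, 0))\<bar> \<le> trace_norm ?D" by (rule trace_norm_traceless_ge)
    also have "\<dots> \<le> \<epsilon>" by (rule good[OF \<sigma> W(2)])
    finally show ?thesis unfolding O target[OF \<sigma>] by simp
  qed
  have "1 - \<epsilon> \<le> Re (circuit_output C U $$ (0, 0)) - Re (circuit_output C V $$ (0, 0))"
  proof -
    have "\<bar>Re (circuit_output C U $$ (0, 0)) - 1\<bar> \<le> \<epsilon> / 2" using close[of 1, OF _ U] by simp
    moreover have "\<bar>Re (circuit_output C V $$ (0, 0))\<bar> \<le> \<epsilon> / 2" using close[of "- 1", OF _ V] by simp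
    ultimately show ?thesis unfolding abs_le_iff by argo
  qed
  also have "\<dots> \<le> 2 * (sqrt 2 / cosh a) * num_queries C"
    using \<open>cosh a > 1\<close> coherent_oracle_near[OF c(1) c'(1)]
    by (intro circuit_output_diff_le wf U V) (auto simp: U_def V_def)
  finally show ?thesis
    using \<open>cosh a > 1\<close> by (simp add: field_simps C_def \<xi>_def a_def)
qed

section \<open>Optimal query complexity\<close>

text \<open>The supremum over \<open>\<xi>\<close> includes the hard instance. The real bound is
  rounded up, so that supremum and infimum are handled in \<open>enat\<close> before the comparison
  moves to \<open>ereal\<close>.\<close>

lemma Q_opt_lower_bound:
  assumes "initial_states \<psi>0" "g > 0" "T > 0" "0 < \<epsilon>" "\<epsilon> < 1"
  shows "ereal ((1 - \<epsilon>) / (2 * sqrt 2) * cosh (g * T / 2)) \<le> ereal_of_enat (Q_opt \<psi>0 g T \<epsilon>)"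
proof -
  define r where "r = (1 - \<epsilon>) / (2 * sqrt 2) * cosh (g * T / 2)"
  have "cosh (g * T / 2) > 1" using assms cosh_real_strict_mono[of 0 "g * T / 2"] by simp
  then have \<xi>: "(1 / cosh (g * T / 2))\<^sup>2 \<in> {0<..<1}" by (simp add: power_divide)
  have "enat (nat \<lceil>r\<rceil>) \<le> Q_wc A g T \<epsilon>" if "solves \<psi>0 A" for A
  proof -
    have "nat \<lceil>r\<rceil> \<le> num_queries (A g T ((1 / cosh (g * T / 2))\<^sup>2) \<epsilon>)"
      using query_lower_bound[OF that assms] by (simp add: r_def nat_ceiling_le_eq)
    then show ?thesis
      unfolding Q_wc_def by (intro SUP_upper2[OF \<xi>]) simp
  qed
  then have "enat (nat \<lceil>r\<rceil>) \<le> Q_opt \<psi>0 g T \<epsilon>"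
    unfolding Q_opt_def by (intro INF_greatest) simp
  then have "ereal_of_enat (enat (nat \<lceil>r\<rceil>)) \<le> ereal_of_enat (Q_opt \<psi>0 g T \<epsilon>)"
    by (simp only: ereal_of_enat_le_iff)
  moreover have "ereal r \<le> ereal_of_enat (enat (nat \<lceil>r\<rceil>))"
    by (simp add: real_nat_ceiling_ge)
  ultimately show ?thesis unfolding r_def[symmetric] by (rule order_trans[rotated])
qed

text \<open>The choice of circuits is made before \<open>\<psi>0\<close> is fixed, so a single
  algorithm works for every choice of global phases.\<close>

lemma optimal_algorithm_exists:
  obtains A :: algorithm where
    "\<And>g T \<xi> \<epsilon>. g > 0 \<Longrightarrow> T > 0 \<Longrightarrow> \<xi> \<in> {0<..<1} \<Longrightarrow> ancilla_free (A g T \<xi> \<epsilon>)"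
    "\<And>\<psi>0. initial_states \<psi>0 \<Longrightarrow> solves \<psi>0 A \<and> prepares_exactly \<psi>0 A"
    "\<And>g T \<epsilon>. g > 0 \<Longrightarrow> T > 0 \<Longrightarrow>
       ereal_of_enat (Q_wc A g T \<epsilon>) \<le> ereal (3 * pi / (2 * sqrt 2) * exp (g * T / 2))"
proof -
  define good where "good = (\<lambda>g T \<xi> C. wf_circuit C \<and> ancilla_free C \<and>
    real (num_queries C) \<le> 3 * pi / (2 * sqrt 2) * exp (g * T / 2) \<and>
    (\<forall>\<sigma> \<in> {1, -1}. \<forall>\<phi> \<in> carrier_vec 2. ketbra \<phi> = bloch_state (initial_bloch \<sigma> \<xi>) \<longrightarrow>
       (\<forall>U. oracle_for \<phi> U \<longrightarrow> circuit_output C U = gp_state g \<phi> T)))"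
  define A :: algorithm where "A = (\<lambda>g T \<xi> \<epsilon>. SOME C. good g T \<xi> C)"
  have good: "good g T \<xi> (A g T \<xi> \<epsilon>)" if "g > 0" "T > 0" "\<xi> \<in> {0<..<1}" for g T \<xi> \<epsilon>
  proof -
    have "\<exists>C. good g T \<xi> C"
      using gp_circuit_exists[of g T \<xi>] that unfolding good_def by (metis greaterThanLessThan_iff)
    then show ?thesis unfolding A_def by (rule someI_ex)
  qed
  show thesis
  proof (rule that[of A])
    fix g T \<xi> \<epsilon> :: real assume "g > 0" "T > 0" "\<xi> \<in> {0<..<1}"
    then show "ancilla_free (A g T \<xi> \<epsilon>)" using good by (simp add: good_def)
  next
    fix \<psi>0 :: "real \<Rightarrow> real \<Rightarrow> complex vec" assume "initial_states \<psi>0"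
    then have exact: "circuit_output (A g T \<xi> \<epsilon>) U = gp_state g (\<psi>0 \<sigma> \<xi>) T"
      if "g > 0" "T > 0" "\<xi> \<in> {0<..<1}" "\<sigma> \<in> {1, -1}" "oracle_for (\<psi>0 \<sigma> \<xi>) U" for g T \<xi> \<epsilon> \<sigma> U
      using good[of g T \<xi> \<epsilon>] that unfolding good_def initial_states_def by blast
    have "trace_norm (circuit_output (A g T \<xi> \<epsilon>) U - gp_state g (\<psi>0 \<sigma> \<xi>) T) = 0"
      if "g > 0" "T > 0" "\<xi> \<in> {0<..<1}" "\<sigma> \<in> {1, -1}" "oracle_for (\<psi>0 \<sigma> \<xi>) U" for g T \<xi> \<epsilon> \<sigma> U
    proof -
      have "circuit_output (A g T \<xi> \<epsilon>) U \<in> carrier_mat 2 2" by (simp add: circuit_output_def)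
      then show ?thesis using exact[OF that, of \<epsilon>] by (metis minus_r_inv_mat trace_norm_zero)
    qed
    then show "solves \<psi>0 A \<and> prepares_exactly \<psi>0 A"
      using exact good unfolding solves_def prepares_exactly_def good_def by fastforce
  next
    fix g T \<epsilon> :: real assume gT: "g > 0" "T > 0"
    define B where "B = 3 * pi / (2 * sqrt 2) * exp (g * T / 2)"
    have "0 \<le> B" by (simp add: B_def)
    \<comment> \<open>Query counts are integers, so the real bound may be rounded down.\<close>
    have "Q_wc A g T \<epsilon> \<le> enat (nat \<lfloor>B\<rfloor>)"
      unfolding Q_wc_def
    proof (rule SUP_least)
      fix \<xi> :: real assume "\<xi> \<in> {0<..<1}"
      then have "real (num_queries (A g T \<xi> \<epsilon>)) \<le> B" using good[OF gT] by (simp add: good_def B_def)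
      then show "enat (num_queries (A g T \<xi> \<epsilon>)) \<le> enat (nat \<lfloor>B\<rfloor>)" by (simp add: le_nat_floor)
    qed
    then have "ereal_of_enat (Q_wc A g T \<epsilon>) \<le> ereal_of_enat (enat (nat \<lfloor>B\<rfloor>))"
      by (simp only: ereal_of_enat_le_iff)
    also have "\<dots> \<le> ereal B" using \<open>0 \<le> B\<close> by simp
    finally show "ereal_of_enat (Q_wc A g T \<epsilon>) \<le> ereal (3 * pi / (2 * sqrt 2) * exp (g * T / 2))"
      unfolding B_def .
  qed
qed

theorem theorem11:
  shows "(\<exists>A :: algorithm.
      (\<forall>g>0. \<forall>T>0. \<forall>\<xi> \<in> {0<..<1}. \<forall>\<epsilon> \<in> {0<..<1}. ancilla_free (A g T \<xi> \<epsilon>)) \<and>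
      (\<forall>\<psi>0. initial_states \<psi>0 \<longrightarrow> solves \<psi>0 A \<and> prepares_exactly \<psi>0 A) \<and>
      (\<forall>g>0. \<forall>T>0. \<forall>\<epsilon> \<in> {0<..<1}.
         ereal_of_enat (Q_wc A g T \<epsilon>) \<le> ereal (3 * pi / (2 * sqrt 2) * exp (g * T / 2)) \<and>
         3 * pi / (2 * sqrt 2) * exp (g * T / 2) \<le> 3 * pi / sqrt 2 * cosh (g * T / 2)))
    \<and> (\<forall>\<epsilon> \<in> {0<..<1}.
        (\<exists>c1>0. \<exists>c2>0. \<exists>\<kappa>>0. \<forall>\<psi>0. initial_states \<psi>0 \<longrightarrow>
           (\<forall>g>0. \<forall>T>0. \<kappa> \<le> g * T \<longrightarrow>
              ereal (c1 * cosh (g * T / 2)) \<le> ereal_of_enat (Q_opt \<psi>0 g T \<epsilon>) \<and>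
              ereal_of_enat (Q_opt \<psi>0 g T \<epsilon>) \<le> ereal (c2 * cosh (g * T / 2)))) \<and>
        (\<exists>c1>0. \<exists>c2>0. \<exists>\<kappa>>0. \<forall>\<psi>0. initial_states \<psi>0 \<longrightarrow>
           (\<forall>g>0. \<forall>T>0. \<kappa> \<le> g * T \<longrightarrow>
              ereal (c1 * exp (g * T / 2)) \<le> ereal_of_enat (Q_opt \<psi>0 g T \<epsilon>) \<and>
              ereal_of_enat (Q_opt \<psi>0 g T \<epsilon>) \<le> ereal (c2 * exp (g * T / 2)))))"
proof -
  obtain A :: algorithm where
    free: "\<And>g T \<xi> \<epsilon>. g > 0 \<Longrightarrow> T > 0 \<Longrightarrow> \<xi> \<in> {0<..<1} \<Longrightarrow> ancilla_free (A g T \<xi> \<epsilon>)"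
    and solves: "\<And>\<psi>0. initial_states \<psi>0 \<Longrightarrow> solves \<psi>0 A \<and> prepares_exactly \<psi>0 A"
    and bound: "\<And>g T \<epsilon>. g > 0 \<Longrightarrow> T > 0 \<Longrightarrow>
       ereal_of_enat (Q_wc A g T \<epsilon>) \<le> ereal (3 * pi / (2 * sqrt 2) * exp (g * T / 2))"
    by (rule optimal_algorithm_exists) (rule that)
  have exp_cosh: "exp x / 2 \<le> cosh x" for x :: real
    by (simp add: cosh_def)
  have exp_le: "3 * pi / (2 * sqrt 2) * exp x \<le> 3 * pi / sqrt 2 * cosh x" for x :: real
  proof -
    have "3 * pi / sqrt 2 * (exp x / 2) \<le> 3 * pi / sqrt 2 * cosh x"
      using exp_cosh by (intro mult_left_mono) auto
    then show ?thesis by (simp add: mult.commute)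
  qed
  have upper: "ereal_of_enat (Q_opt \<psi>0 g T \<epsilon>) \<le> ereal (3 * pi / (2 * sqrt 2) * exp (g * T / 2))"
    if "initial_states \<psi>0" "g > 0" "T > 0" for \<psi>0 g T \<epsilon>
  proof -
    have "Q_opt \<psi>0 g T \<epsilon> \<le> Q_wc A g T \<epsilon>"
      unfolding Q_opt_def using solves[OF that(1)] by (intro INF_lower) simp
    then show ?thesis using bound[OF that(2,3), of \<epsilon>]
      by (meson ereal_of_enat_le_iff order_trans)
  qed
  have cosh_bounds: "ereal ((1 - \<epsilon>) / (2 * sqrt 2) * cosh (g * T / 2)) \<le> ereal_of_enat (Q_opt \<psi>0 g T \<epsilon>) \<and>
      ereal_of_enat (Q_opt \<psi>0 g T \<epsilon>) \<le> ereal (3 * pi / sqrt 2 * cosh (g * T / 2))"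
    if "initial_states \<psi>0" "g > 0" "T > 0" "\<epsilon> \<in> {0<..<1}" for \<psi>0 g T \<epsilon>
  proof
    show "ereal ((1 - \<epsilon>) / (2 * sqrt 2) * cosh (g * T / 2)) \<le> ereal_of_enat (Q_opt \<psi>0 g T \<epsilon>)"
      using Q_opt_lower_bound that by simp
    show "ereal_of_enat (Q_opt \<psi>0 g T \<epsilon>) \<le> ereal (3 * pi / sqrt 2 * cosh (g * T / 2))"
      by (rule order_trans[OF upper[OF that(1-3)]]) (simp only: ereal_less_eq exp_le)
  qed
  \<comment> \<open>Passing from cosh to half of exp halves the constant.\<close>
  have exp_bounds: "ereal ((1 - \<epsilon>) / (4 * sqrt 2) * exp (g * T / 2)) \<le> ereal_of_enat (Q_opt \<psi>0 g T \<epsilon>)"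
    if "initial_states \<psi>0" "g > 0" "T > 0" "\<epsilon> \<in> {0<..<1}" for \<psi>0 g T \<epsilon>
  proof -
    have "(1 - \<epsilon>) / (2 * sqrt 2) * (exp (g * T / 2) / 2) \<le> (1 - \<epsilon>) / (2 * sqrt 2) * cosh (g * T / 2)"
      using that(4) exp_cosh by (intro mult_left_mono) auto
    then have "ereal ((1 - \<epsilon>) / (4 * sqrt 2) * exp (g * T / 2)) \<le> ereal ((1 - \<epsilon>) / (2 * sqrt 2) *
        cosh (g * T / 2))"
      by simp
    then show ?thesis using cosh_bounds[OF that] by (meson order_trans)
  qed
  have "\<exists>c1>0. \<exists>c2>0. \<exists>\<kappa>>0. \<forall>\<psi>0. initial_states \<psi>0 \<longrightarrow>
       (\<forall>g>0. \<forall>T>0. \<kappa> \<le> g * T \<longrightarrow>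
          ereal (c1 * cosh (g * T / 2)) \<le> ereal_of_enat (Q_opt \<psi>0 g T \<epsilon>) \<and>
          ereal_of_enat (Q_opt \<psi>0 g T \<epsilon>) \<le> ereal (c2 * cosh (g * T / 2)))"
    if "\<epsilon> \<in> {0<..<1}" for \<epsilon>
    using cosh_bounds that
    by (intro exI[of _ "(1 - \<epsilon>) / (2 * sqrt 2)"] exI[of _ "3 * pi / sqrt 2"] exI[of _ 1] conjI allI
        impI) auto
  moreover have "\<exists>c1>0. \<exists>c2>0. \<exists>\<kappa>>0. \<forall>\<psi>0. initial_states \<psi>0 \<longrightarrow>
       (\<forall>g>0. \<forall>T>0. \<kappa> \<le> g * T \<longrightarrow>
          ereal (c1 * exp (g * T / 2)) \<le> ereal_of_enat (Q_opt \<psi>0 g T \<epsilon>) \<and>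
          ereal_of_enat (Q_opt \<psi>0 g T \<epsilon>) \<le> ereal (c2 * exp (g * T / 2)))"
    if "\<epsilon> \<in> {0<..<1}" for \<epsilon>
    using exp_bounds upper that
    by (intro exI[of _ "(1 - \<epsilon>) / (4 * sqrt 2)"] exI[of _ "3 * pi / (2 * sqrt 2)"] exI[of _ 1] conjI
        allI impI) auto
  ultimately show ?thesis
    using free solves bound exp_le by (intro conjI exI[of _ A]) auto
qed

end
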